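(* For $v\in L^2_{\mathbb{C}}(0,1)$, $\overline{v}(1-x)=-v(x)$, $\|v\|=1$, the non-local potential $\{\alpha,v\}$ can be recovered by the three spectra $\sigma(L_0)$, $\sigma(L_\alpha(v))$ and $\sigma(L_\alpha(v+\tilde h))$, where $\tilde h(x)=(x-\tfrac12)^2\mathrm{i}$.
   Context: Throughout, $\alpha\in\mathbb{R}$, and $\langle f,g\rangle=\int_0^1 f(x)\overline{g(x)}\,dx$, $\|f\|=\langle f,f\rangle^{1/2}$ on $L^2_{\mathbb{C}}(0,1)$. For $v\in L^2_{\mathbb{C}}(0,1)$, the self-adjoint operator $L_\alpha(v)$ in $L^2_{\mathbb{C}}(0,1)$ is $(L_\alpha(v)y)(x)=\mathrm{i}y'''(x)+\alpha\langle y,v\rangle v(x)$ with domain $\{y\in W_3^2(0,1): y(1)=y(0),\ y'(1)=y'(0),\ y''(1)=y''(0)\}$, where $W_3^2(0,1)$ is the Sobolev space of functions with three derivatives in $L^2$; $L_0$ is the operator $L_0y=\mathrm{i}y'''$ with the same domain. $\sigma(\cdot)$ denotes the spectrum, and $\overline{v}$ is the complex conjugate of $v$.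
   Formalization: Recovery of v is claimed only for α ≠ 0 (for α = 0 the operators do not depend on v, so v cannot be recovered); α is always recovered. The three spectra are taken with multiplicities of eigenvalues. *)

theory Defs
  imports "HOL-Analysis.Analysis" "HOL-Library.Function_Algebras"
begin

text \<open>
  Elements of the complex Hilbert space of square-integrable functions on the interval from 0 to 1
  are represented by functions on the reals whose values outside the interval are irrelevant;
  equality in the Hilbert space is equality almost everywhere on the interval.
\<close>

abbreviation leb01 :: "real measure" where
  "leb01 \<equiv> lebesgue_on {0..1}"

definition L2 :: "(real \<Rightarrow> complex) set" where
  "L2 = {f. f \<in> borel_measurable leb01 \<and> integrable leb01 (\<lambda>x. (cmod (f x))\<^sup>2)}"

definition L2_inner :: "(real \<Rightarrow> complex) \<Rightarrow> (real \<Rightarrow> complex) \<Rightarrow> complex" where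
  "L2_inner f g = (LINT x|leb01. f x * cnj (g x))"

definition L2_norm :: "(real \<Rightarrow> complex) \<Rightarrow> real" where
  "L2_norm f = sqrt (LINT x|leb01. (cmod (f x))\<^sup>2)"

text \<open>
  \<open>sobolev_deriv f g\<close>: the function \<open>f\<close> is absolutely continuous on the interval, with
  square-integrable (weak) derivative \<open>g\<close>. This makes \<open>f\<close> the continuous representative
  of its class, so that its boundary values are meaningful.
\<close>

definition sobolev_deriv :: "(real \<Rightarrow> complex) \<Rightarrow> (real \<Rightarrow> complex) \<Rightarrow> bool" where
  "sobolev_deriv f g \<longleftrightarrow> g \<in> L2 \<and> (\<forall>x\<in>{0..1}. f x = f 0 + (LINT t|lebesgue_on {0..x}. g t))"

text \<open>
  An unbounded operator \<open>T\<close> is represented by its graph: \<open>T y f\<close> says that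
  \<open>y\<close> is in the domain and \<open>T y = f\<close> almost everywhere.
  Elements of the domain are taken to be continuous on the interval and 0 outside it, so each of
  them has exactly one representing function, whereas \<open>f\<close> is determined almost everywhere only.
\<close>

type_synonym L2_operator = "(real \<Rightarrow> complex) \<Rightarrow> (real \<Rightarrow> complex) \<Rightarrow> bool"

definition L_zero :: L2_operator where
  "L_zero y f \<longleftrightarrow> (\<forall>x. x \<notin> {0..1} \<longrightarrow> y x = 0) \<and>
     (\<exists>y1 y2 y3. sobolev_deriv y y1 \<and> sobolev_deriv y1 y2 \<and> sobolev_deriv y2 y3 \<and>
        y 1 = y 0 \<and> y1 1 = y1 0 \<and> y2 1 = y2 0 \<and>
        f \<in> L2 \<and> (AE x in leb01. f x = \<i> * y3 x))"

definition L_nonlocal :: "real \<Rightarrow> (real \<Rightarrow> complex) \<Rightarrow> L2_operator" where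
  "L_nonlocal \<alpha> v y f \<longleftrightarrow> f \<in> L2 \<and>
     (\<exists>g. L_zero y g \<and>
        (AE x in leb01. f x = g x + complex_of_real \<alpha> * L2_inner y v * v x))"

text \<open>
  A number is in the resolvent set if \<open>T - \<mu>\<close> maps the domain bijectively onto the
  Hilbert space, with bounded inverse. (The norm bound includes injectivity.)
\<close>

definition resolvent_set :: "L2_operator \<Rightarrow> complex set" where
  "resolvent_set T = {\<mu>.
     (\<forall>g\<in>L2. \<exists>y f. T y f \<and> (AE x in leb01. f x - \<mu> * y x = g x)) \<and>
     (\<exists>C. \<forall>y f. T y f \<longrightarrow> L2_norm y \<le> C * L2_norm (\<lambda>x. f x - \<mu> * y x))}"

definition op_spectrum :: "L2_operator \<Rightarrow> complex set" where
  "op_spectrum T = - resolvent_set T"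

interpretation cfun: vector_space "\<lambda>(c::complex) (f::real \<Rightarrow> complex) x. c * f x"
  by unfold_locales (auto simp: fun_eq_iff algebra_simps)

definition eigenspace :: "L2_operator \<Rightarrow> complex \<Rightarrow> (real \<Rightarrow> complex) set" where
  "eigenspace T \<mu> = {y. \<exists>f. T y f \<and> (AE x in leb01. f x = \<mu> * y x)}"

text \<open>
  The spectrum counted with multiplicity. The operators considered here are self-adjoint
  with compact resolvent, so every spectral point is an eigenvalue and its multiplicity is the
  (finite) dimension of the eigenspace. Functions in the domain being equal almost everywhere only
  if they are equal, this dimension may be computed in the vector space of functions.
\<close>

definition spectrum_mult :: "L2_operator \<Rightarrow> (complex \<times> nat) set" where
  "spectrum_mult T = {(\<mu>, m). \<mu> \<in> op_spectrum T \<and> m = cfun.dim (eigenspace T \<mu>)}"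

definition h_tilde :: "real \<Rightarrow> complex" where
  "h_tilde x = complex_of_real ((x - 1/2)\<^sup>2) * \<i>"

end

theory Submission
  imports Defs "HOL-Complex_Analysis.Complex_Analysis"
begin

text \<open>
  Write \<open>v n\<close> and \<open>h n\<close> for the Fourier coefficients of \<open>v\<close> and
  \<open>h_tilde\<close>. In the Fourier basis \<open>L_zero\<close> is diagonal with the simple
  eigenvalues \<open>\<lambda> n = (2 \<pi> n)\<^sup>3\<close>, and the eigenvalues of the rank-one
  perturbation are governed by \<open>F z = 1 + \<alpha> * (\<Sum>n. \<bar>v n\<bar>\<^sup>2 /
  (\<lambda> n - z))\<close>: the multiplicity of a real \<open>a\<close> is the order of
  \<open>F\<close> at \<open>a\<close>, plus 1 if \<open>a\<close> is some \<open>\<lambda> n\<close>.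
  So for two potentials with the same spectrum the quotient of the two functions \<open>F\<close> is
  entire without zeros. Off the real axis neither function takes a value in \<open>(-\<infinity>,
  0]\<close>, so a logarithm of the quotient has a bounded imaginary part and is constant; since both
  functions tend to 1 along the imaginary axis they are equal, and their residues show that the spectrum
  determines all the products \<open>\<alpha> * \<bar>v n\<bar>\<^sup>2\<close>. Parseval's identity and
  \<open>\<parallel>v\<parallel> = 1\<close> give \<open>\<alpha>\<close>. The antisymmetry of
  \<open>v\<close> and \<open>h_tilde\<close> makes all their Fourier coefficients imaginary, and those
  of \<open>h_tilde\<close> do not vanish; hence \<open>\<bar>v n\<bar>\<close> and \<open>\<bar>v n + h
  n\<bar>\<close> determine \<open>v n\<close>.
\<close>

subsection \<open>Sums of simple fractions with real poles\<close>

text \<open>Recovery maps exist as soon as the spectra determine the potential, because a choice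
  function may pick any potential compatible with the data. The delicate points are the real ones: a
  \<open>cube_freq n\<close> whose weight vanishes stays an eigenvalue, and the determinant may be
  zero there as well, which gives multiplicity 2; a nonzero weight instead cancels the unperturbed
  eigenvalue. Recording orders -1, 0 and 1 at all real points treats these cases uniformly. Two
  determinants are compared through the values that they omit rather than through their growth, so
  neither product expansions nor asymptotics of eigenvalues enter. Parseval's identity serves more
  than the recovery of \<alpha>: as completeness of the exponentials it shows that the coefficient
  equations describe the whole eigenspace, and it makes the weights summable, so that the
  determinant is well defined.\<close>

lemma summable_on_div_ge:
  fixes c d :: "'i \<Rightarrow> 'a::real_normed_field"
  assumes "(\<lambda>n. norm (c n)) summable_on A" "\<delta> > 0"
    "\<And>n. n \<in> A \<Longrightarrow> c n \<noteq> 0 \<Longrightarrow> \<delta> \<le> norm (d n)"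
  shows "(\<lambda>n. norm (c n / d n)) summable_on A"
proof (rule summable_on_comparison_test)
  show "(\<lambda>n. (1 / \<delta>) * norm (c n)) summable_on A"
    using assms(1) by (rule summable_on_cmult_right)
  show "norm (c n / d n) \<le> 1 / \<delta> * norm (c n)" if "n \<in> A" for n
  proof (cases "c n = 0")
    case False
    have "norm (c n) / norm (d n) \<le> norm (c n) / \<delta>"
      by (intro divide_left_mono assms(3)[OF that False] mult_pos_pos)
         (use assms(2) assms(3)[OF that False] in auto)
    thus ?thesis by (simp add: norm_divide)
  qed auto
qed auto

text \<open>The complex analysis uses only that the poles are spaced apart; gap 1 is a normalisation
  that the frequencies \<open>cube_freq\<close> meet with room to spare. It makes every subset of
  the poles closed, so poles with vanishing coefficient can be ignored.\<close>

locale separated_reals =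
  fixes lam :: "'i \<Rightarrow> real"
  assumes separated: "m \<noteq> n \<Longrightarrow> 1 \<le> \<bar>lam m - lam n\<bar>"
begin

definition pole_sum :: "('i \<Rightarrow> complex) \<Rightarrow> complex \<Rightarrow> complex" where
  "pole_sum c z = (\<Sum>\<^sub>\<infinity>n. c n / (of_real (lam n) - z))"

lemma lam_eq_iff [simp]: "lam m = lam n \<longleftrightarrow> m = n"
  using separated[of m n] by (cases "m = n") auto

lemma closed_poles: "closed ((\<lambda>n. complex_of_real (lam n)) ` A)"
proof (rule discrete_imp_closed[of 1])
  show "\<forall>x\<in>(\<lambda>n. complex_of_real (lam n)) ` A. \<forall>y\<in>(\<lambda>n. complex_of_real (lam n)) ` A. dist y x < 1 \<longrightarrow> y = x"
    using separated by (fastforce simp: dist_norm norm_of_real simp flip: of_real_diff)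
qed simp

text \<open>One radius has to bound all denominators from below, uniformly in \<open>w\<close>,
  since it becomes the constant of the M-test in \<open>pole_sum_analytic\<close>. Only poles with
  nonzero coefficient count, so \<open>z\<close> may lie on another one.\<close>

lemma dist_poles:
  fixes c :: "'i \<Rightarrow> complex" and z :: complex
  assumes "\<And>n. c n \<noteq> 0 \<Longrightarrow> z \<noteq> of_real (lam n)"
  obtains \<delta> where "\<delta> > 0" "\<And>n w. c n \<noteq> 0 \<Longrightarrow> w \<in> cball z \<delta> \<Longrightarrow> \<delta> \<le> norm (of_real (lam n) - w)"
proof -
  let ?S = "(\<lambda>n. complex_of_real (lam n)) ` {n. c n \<noteq> 0}"
  have "open (- ?S)" using closed_poles by blast
  moreover have "z \<in> - ?S" using assms by auto
  ultimately obtain e where e: "e > 0" "ball z e \<subseteq> - ?S"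
    using open_contains_ball by blast
  show ?thesis
  proof (rule that[of "e/2"])
    fix n w assume n: "c n \<noteq> 0" and w: "w \<in> cball z (e/2)"
    have "of_real (lam n) \<notin> ball z e" using e n by auto
    hence "e \<le> dist z (of_real (lam n))" by simp
    also have "\<dots> \<le> dist z w + dist w (of_real (lam n))" by (rule dist_triangle)
    finally show "e/2 \<le> norm (of_real (lam n) - w)" using w by (auto simp: dist_norm norm_minus_commute)
  qed (use e in auto)
qed

lemma pole_sum_summable:
  fixes c :: "'i \<Rightarrow> complex"
  assumes "(\<lambda>n. norm (c n)) summable_on UNIV"
  shows "(\<lambda>n. norm (c n / (of_real (lam n) - z))) summable_on UNIV"
proof -
  \<comment> \<open>At a pole the division by zero makes the term 0. Zeroing the coefficient gives
    the same series and lets \<open>dist_poles\<close> apply.\<close>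
  define c' where "c' n = (if z = of_real (lam n) then 0 else c n)" for n
  have "z \<noteq> of_real (lam n)" if "c' n \<noteq> 0" for n
    using that by (auto simp: c'_def split: if_splits)
  then obtain \<delta> where "\<delta> > 0" "\<And>n w. c' n \<noteq> 0 \<Longrightarrow> w \<in> cball z \<delta> \<Longrightarrow> \<delta> \<le> norm (of_real (lam n) - w)"
    using dist_poles[of c' z] by blast
  moreover have "(\<lambda>n. norm (c' n)) summable_on UNIV"
    by (rule summable_on_comparison_test[OF assms]) (auto simp: c'_def)
  ultimately have "(\<lambda>n. norm (c' n / (of_real (lam n) - z))) summable_on UNIV"
    by (intro summable_on_div_ge[of c' UNIV \<delta>]) auto
  also have "(\<lambda>n. norm (c' n / (of_real (lam n) - z))) = (\<lambda>n. norm (c n / (of_real (lam n) - z)))"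
    by (auto simp: c'_def)
  finally show ?thesis .
qed

lemma pole_sum_has_sum:
  assumes "(\<lambda>n. norm (c n)) summable_on UNIV"
  shows "((\<lambda>n. c n / (of_real (lam n) - z)) has_sum pole_sum c z) UNIV"
  unfolding pole_sum_def
  by (rule has_sum_infsum[OF abs_summable_summable[OF pole_sum_summable[OF assms]]])

text \<open>On a small closed ball the terms are dominated by \<open>norm (c n) / \<delta>\<close>,
  so the partial sums, holomorphic there, converge uniformly.\<close>

lemma pole_sum_analytic:
  assumes "(\<lambda>n. norm (c n)) summable_on UNIV" "\<And>n. c n \<noteq> 0 \<Longrightarrow> z \<noteq> of_real (lam n)"
  shows "pole_sum c analytic_on {z}"
proof -
  from dist_poles[of c z, OF assms(2)]
  obtain \<delta> where \<delta>: "\<delta> > 0" "\<And>n w. c n \<noteq> 0 \<Longrightarrow> w \<in> cball z \<delta> \<Longrightarrow> \<delta> \<le> norm (of_real (lam n) - w)"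
    by blast
  let ?f = "\<lambda>n w. c n / (of_real (lam n) - w)"
  have hol: "?f n holomorphic_on cball z \<delta>" for n
  proof (cases "c n = 0")
    case False
    have "of_real (lam n) - w \<noteq> 0" if "w \<in> cball z \<delta>" for w
      using \<delta>(2)[OF False that] \<delta>(1) by auto
    thus ?thesis by (intro holomorphic_intros) auto
  qed auto
  have ul: "uniform_limit (cball z \<delta>) (\<lambda>X w. \<Sum>n\<in>X. ?f n w) (\<lambda>w. \<Sum>\<^sub>\<infinity>n. ?f n w) (finite_subsets_at_top UNIV)"
  proof (rule Weierstrass_m_test_general)
    show "(\<lambda>n. (1/\<delta>) * norm (c n)) summable_on UNIV"
      using assms(1) by (rule summable_on_cmult_right)
    fix n w assume w: "w \<in> cball z \<delta>"
    show "norm (?f n w) \<le> (1/\<delta>) * norm (c n)"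
    proof (cases "c n = 0")
      case False
      have "norm (c n) / norm (of_real (lam n) - w) \<le> norm (c n) / \<delta>"
        by (intro divide_left_mono \<delta>(2)[OF False w] mult_pos_pos)
           (use \<delta>(1) \<delta>(2)[OF False w] in auto)
      thus ?thesis by (simp add: norm_divide)
    qed auto
  qed
  have "(\<lambda>w. \<Sum>\<^sub>\<infinity>n. ?f n w) holomorphic_on ball z \<delta>"
  proof (rule holomorphic_uniform_limit[OF _ ul])
    show "\<forall>\<^sub>F X in finite_subsets_at_top UNIV. continuous_on (cball z \<delta>) (\<lambda>w. \<Sum>n\<in>X. ?f n w) \<and>
            (\<lambda>w. \<Sum>n\<in>X. ?f n w) holomorphic_on ball z \<delta>"
    proof (intro always_eventually allI)
      fix X :: "'i set"
      have "(\<lambda>w. \<Sum>n\<in>X. ?f n w) holomorphic_on cball z \<delta>"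
        by (intro holomorphic_on_sum hol)
      thus "continuous_on (cball z \<delta>) (\<lambda>w. \<Sum>n\<in>X. ?f n w) \<and> (\<lambda>w. \<Sum>n\<in>X. ?f n w) holomorphic_on ball z \<delta>"
        using ball_subset_cball holomorphic_on_imp_continuous_on holomorphic_on_subset by blast
    qed
  qed auto
  thus ?thesis
    unfolding pole_sum_def[abs_def] using \<delta>(1) by (auto simp: analytic_at intro!: exI[of _ "ball z \<delta>"])
qed

text \<open>Division by zero drops the term with \<open>lam n = z\<close> from \<open>perturb_det \<alpha> p z\<close>; at such a point this
  is the value relevant for the eigenspace when \<open>\<alpha> * p n = 0\<close>.\<close>

definition perturb_det :: "real \<Rightarrow> ('i \<Rightarrow> real) \<Rightarrow> complex \<Rightarrow> complex" where
  "perturb_det \<alpha> p z = 1 + of_real \<alpha> * pole_sum (\<lambda>n. of_real (p n)) z"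

lemma norm_im_le: "\<bar>Im z\<bar> \<le> norm (complex_of_real x - z)"
  using abs_Im_le_cmod[of "complex_of_real x - z"] by simp

lemma perturb_det_analytic:
  assumes "p summable_on UNIV" "\<And>n. 0 \<le> p n" "z \<notin> \<real>"
  shows "perturb_det \<alpha> p analytic_on {z}"
proof -
  have "pole_sum (\<lambda>n. of_real (p n)) analytic_on {z}"
    by (rule pole_sum_analytic) (use assms in auto)
  thus ?thesis unfolding perturb_det_def[abs_def] by (intro analytic_intros)
qed

text \<open>Off the real axis \<open>perturb_det \<alpha> p\<close> is 1 or has an imaginary part of the sign of
  \<open>\<alpha> * Im z\<close>.\<close>

lemma perturb_det_off_axis:
  assumes p: "p summable_on UNIV" "\<And>n. 0 \<le> p n" and z: "z \<notin> \<real>"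
  shows "perturb_det \<alpha> p z \<notin> \<real>\<^sub>\<le>\<^sub>0"
proof
  assume neg: "perturb_det \<alpha> p z \<in> \<real>\<^sub>\<le>\<^sub>0"
  have Imz: "Im z \<noteq> 0" using z complex_is_Real_iff by blast
  let ?f = "\<lambda>n. complex_of_real (p n) / (of_real (lam n) - z)"
  let ?g = "\<lambda>n. p n / (norm (of_real (lam n) - z))\<^sup>2"
  have "(?f has_sum pole_sum (\<lambda>n. of_real (p n)) z) UNIV"
    by (rule pole_sum_has_sum) (use p in auto)
  hence "((\<lambda>n. Im (?f n)) has_sum Im (pole_sum (\<lambda>n. of_real (p n)) z)) UNIV"
    by (rule has_sum_Im)
  also have "(\<lambda>n. Im (?f n)) = (\<lambda>n. Im z * ?g n)"
    by (rule ext) (simp add: Im_divide cmod_power2)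
  finally have hs: "((\<lambda>n. Im z * ?g n) has_sum Im (pole_sum (\<lambda>n. of_real (p n)) z)) UNIV" .
  have "\<alpha> * Im (pole_sum (\<lambda>n. of_real (p n)) z) = 0"
    using neg unfolding perturb_det_def by (auto simp: complex_nonpos_Reals_iff)
  moreover have "perturb_det \<alpha> p z \<noteq> 1" using neg by auto
  hence "\<alpha> \<noteq> 0" by (auto simp: perturb_det_def)
  ultimately have hs0: "((\<lambda>n. Im z * ?g n) has_sum 0) UNIV" using hs by simp
  hence "((\<lambda>n. inverse (Im z) * (Im z * ?g n)) has_sum (inverse (Im z) * 0)) UNIV"
    by (rule has_sum_cmult_right)
  hence "(?g has_sum 0) UNIV" using Imz by (simp add: mult.assoc[symmetric])
  hence "?g n = 0" for n
    using nonneg_has_sum_le_0D[of ?g UNIV 0 n] p by auto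
  moreover have "complex_of_real (lam n) - z \<noteq> 0" for n using z by auto
  ultimately have "p n = 0" for n by (metis divide_eq_0_iff norm_eq_zero power_eq_0_iff)
  hence "perturb_det \<alpha> p z = 1" by (simp add: perturb_det_def pole_sum_def)
  thus False using \<open>perturb_det \<alpha> p z \<noteq> 1\<close> by simp
qed

text \<open>Every denominator has norm at least \<open>\<bar>Im z\<bar>\<close>. The bound supplies
  the normalisation at infinity that fixes a constant factor between two determinants.\<close>

lemma perturb_det_asymp:
  assumes p: "p summable_on UNIV" "\<And>n. 0 \<le> p n" and z: "z \<notin> \<real>"
  shows "norm (perturb_det \<alpha> p z - 1) \<le> \<bar>\<alpha>\<bar> * (\<Sum>\<^sub>\<infinity>n. p n) / \<bar>Im z\<bar>"
proof -
  have Imz: "Im z \<noteq> 0" using z complex_is_Real_iff by blast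
  have "norm (pole_sum (\<lambda>n. of_real (p n)) z) \<le> (\<Sum>\<^sub>\<infinity>n. p n / \<bar>Im z\<bar>)"
    unfolding pole_sum_def
  proof (rule norm_infsum_le)
    show "((\<lambda>n. complex_of_real (p n) / (complex_of_real (lam n) - z)) has_sum
        (\<Sum>\<^sub>\<infinity>n. complex_of_real (p n) / (complex_of_real (lam n) - z))) UNIV"
      using pole_sum_has_sum[of "\<lambda>n. of_real (p n)" z] p unfolding pole_sum_def by auto
    show "((\<lambda>n. p n / \<bar>Im z\<bar>) has_sum (\<Sum>\<^sub>\<infinity>n. p n / \<bar>Im z\<bar>)) UNIV"
      using summable_on_cmult_left[OF p(1), of "1 / \<bar>Im z\<bar>"] by (intro has_sum_infsum) simp
    show "norm (complex_of_real (p n) / (complex_of_real (lam n) - z)) \<le> p n / \<bar>Im z\<bar>" for n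
    proof -
      have "0 < norm (complex_of_real (lam n) - z)" using norm_im_le[of z "lam n"] Imz by linarith
      thus ?thesis
        using p(2)[of n] norm_im_le[of z "lam n"] Imz by (auto simp: norm_divide intro!: divide_left_mono)
    qed
  qed
  also have "\<dots> = (\<Sum>\<^sub>\<infinity>n. p n) / \<bar>Im z\<bar>"
    using infsum_cmult_left'[of p "1/\<bar>Im z\<bar>" UNIV] by simp
  finally show ?thesis
    using mult_left_mono[of _ _ "\<bar>\<alpha>\<bar>"] by (force simp: perturb_det_def norm_mult)
qed

section \<open>Order of the determinant at real points\<close>

definition det_order :: "real \<Rightarrow> ('i \<Rightarrow> real) \<Rightarrow> real \<Rightarrow> int" where
  "det_order \<alpha> p a = (if \<exists>n. lam n = a \<and> \<alpha> * p n \<noteq> 0 then -1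
     else if perturb_det \<alpha> p (of_real a) = 0 then 1 else 0)"

text \<open>The remainder is regular at \<open>lam m\<close>; both the order and the residue there
  are read off from this form.\<close>

lemma perturb_det_split:
  assumes p: "p summable_on UNIV" "\<And>n. 0 \<le> p n"
  shows "perturb_det \<alpha> p z = perturb_det \<alpha> (p(m := 0)) z + of_real (\<alpha> * p m) / (of_real (lam m) - z)"
proof -
  let ?f = "\<lambda>n. complex_of_real (p n) / (of_real (lam n) - z)"
  let ?h = "\<lambda>n. complex_of_real ((p(m := 0)) n) / (of_real (lam n) - z)"
  have "(?f has_sum pole_sum (\<lambda>n. of_real (p n)) z) UNIV"
    by (rule pole_sum_has_sum) (use p in auto)
  moreover have "((\<lambda>n. if n = m then - ?f m else 0) has_sum - ?f m) UNIV"
    by (rule has_sum_finite_neutralI[of "{m}"]) auto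
  ultimately have "((\<lambda>n. ?f n + (if n = m then - ?f m else 0)) has_sum (pole_sum (\<lambda>n. of_real (p n)) z + - ?f m)) UNIV"
    by (rule has_sum_add)
  also have "(\<lambda>n. ?f n + (if n = m then - ?f m else 0)) = ?h" by auto
  finally have "pole_sum (\<lambda>n. of_real ((p(m := 0)) n)) z = pole_sum (\<lambda>n. of_real (p n)) z - ?f m"
    unfolding pole_sum_def using infsumI by fastforce
  hence "pole_sum (\<lambda>n. of_real (p n)) z = pole_sum (\<lambda>n. of_real ((p(m := 0)) n)) z + ?f m"
    by simp
  thus ?thesis unfolding perturb_det_def by (simp only: distrib_left add.assoc of_real_mult times_divide_eq_right)
qed

lemma summable_on_fun_upd_0:
  fixes p :: "'i \<Rightarrow> real"
  assumes "p summable_on UNIV" "\<And>n. 0 \<le> p n"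
  shows "p(m := 0) summable_on UNIV"
  by (rule summable_on_comparison_test[OF assms(1)]) (use assms(2) in auto)

text \<open>Real zeros are simple: F(z) - F(a) is \<alpha> (z - a) times the sum of
  \<open>p n / ((lam n - a) * (lam n - z))\<close>, and at z = a this sum has the nonnegative terms
  \<open>p n / (lam n - a)\<^sup>2\<close>. If all of them vanished, F would be constantly 1 and
  could not be zero at a.\<close>

lemma perturb_det_local_regular:
  assumes p: "p summable_on UNIV" "\<And>n. 0 \<le> p n"
    and reg: "\<And>n. p n \<noteq> 0 \<Longrightarrow> lam n \<noteq> a"
  obtains u where "u analytic_on {of_real a}" "u (of_real a) \<noteq> 0"
    "\<forall>\<^sub>F z in at (of_real a). perturb_det \<alpha> p z =
       (if perturb_det \<alpha> p (of_real a) = 0 then z - of_real a else 1) * u z"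
proof (cases "perturb_det \<alpha> p (of_real a) = 0")
  case False
  have "pole_sum (\<lambda>n. of_real (p n)) analytic_on {of_real a}"
    by (rule pole_sum_analytic) (use assms in auto)
  hence "perturb_det \<alpha> p analytic_on {of_real a}"
    unfolding perturb_det_def[abs_def] by (intro analytic_intros)
  thus ?thesis using that[of "perturb_det \<alpha> p"] False by simp
next
  case True
  define c where "c n = complex_of_real (p n) / (of_real (lam n) - of_real a)" for n
  define u where "u z = of_real \<alpha> * pole_sum c z" for z
  have c: "(\<lambda>n. norm (c n)) summable_on UNIV"
    unfolding c_def by (rule pole_sum_summable) (use p in auto)
  have "pole_sum c analytic_on {of_real a}"
    by (rule pole_sum_analytic[OF c]) (use reg in \<open>auto simp: c_def\<close>)
  hence "u analytic_on {of_real a}"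
    unfolding u_def[abs_def] by (intro analytic_intros)
  moreover have "u (of_real a) \<noteq> 0"
  proof
    assume "u (of_real a) = 0"
    moreover have "\<alpha> \<noteq> 0" using True by (auto simp: perturb_det_def)
    ultimately have "pole_sum c (of_real a) = 0" by (simp add: u_def)
    with pole_sum_has_sum[OF c, of "of_real a"]
    have "((\<lambda>n. c n / (of_real (lam n) - of_real a)) has_sum 0) UNIV" by simp
    hence "((\<lambda>n. Re (c n / (of_real (lam n) - of_real a))) has_sum Re 0) UNIV"
      by (rule has_sum_Re)
    also have "(\<lambda>n. Re (c n / (of_real (lam n) - of_real a))) = (\<lambda>n. p n / (lam n - a)\<^sup>2)"
      unfolding c_def by (rule ext) (simp add: power2_eq_square flip: of_real_diff of_real_divide)
    finally have hs: "((\<lambda>n. p n / (lam n - a)\<^sup>2) has_sum 0) UNIV" by simp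
    have "p n / (lam n - a)\<^sup>2 = 0" for n
      using nonneg_has_sum_le_0D[OF hs, of n] p by auto
    hence "p n = 0" for n
      using reg[of n] by (metis divide_eq_0_iff eq_iff_diff_eq_0 power_eq_0_iff)
    thus False using True by (simp add: perturb_det_def pole_sum_def)
  qed
  moreover have "perturb_det \<alpha> p z = (z - of_real a) * u z" if z: "\<And>n. p n \<noteq> 0 \<Longrightarrow> z \<noteq> of_real (lam n)" for z
  proof -
    let ?f = "\<lambda>z n. complex_of_real (p n) / (of_real (lam n) - z)"
    have hs: "(?f z has_sum pole_sum (\<lambda>n. of_real (p n)) z) UNIV" for z
      by (rule pole_sum_has_sum) (use p in auto)
    have "((\<lambda>n. - ?f (of_real a) n) has_sum - pole_sum (\<lambda>n. of_real (p n)) (of_real a)) UNIV"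
      using hs by (subst has_sum_uminus) auto
    from has_sum_add[OF hs this]
    have "((\<lambda>n. ?f z n + - ?f (of_real a) n) has_sum
        (pole_sum (\<lambda>n. of_real (p n)) z + - pole_sum (\<lambda>n. of_real (p n)) (of_real a))) UNIV" .
    moreover have "((\<lambda>n. (z - of_real a) * (c n / (of_real (lam n) - z))) has_sum
       ((z - of_real a) * pole_sum c z)) UNIV"
      by (intro has_sum_cmult_right pole_sum_has_sum c)
    moreover have "?f z n + - ?f (of_real a) n = (z - of_real a) * (c n / (of_real (lam n) - z))" for n
    proof (cases "p n = 0")
      case False
      hence "of_real (lam n) - z \<noteq> 0" "of_real (lam n) - complex_of_real a \<noteq> 0"
        using z[of n] reg[of n] by auto
      thus ?thesis by (simp add: c_def divide_simps) (simp add: algebra_simps)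
    qed (auto simp: c_def)
    ultimately have "pole_sum (\<lambda>n. of_real (p n)) z + - pole_sum (\<lambda>n. of_real (p n)) (of_real a) =
        (z - of_real a) * pole_sum c z"
      using has_sum_unique by force
    hence *: "pole_sum (\<lambda>n. of_real (p n)) z =
        (z - of_real a) * pole_sum c z + pole_sum (\<lambda>n. of_real (p n)) (of_real a)"
      by (simp add: algebra_simps)
    have "perturb_det \<alpha> p z = (z - of_real a) * u z + perturb_det \<alpha> p (of_real a)"
      unfolding u_def perturb_det_def * by (simp add: algebra_simps)
    thus ?thesis using True by simp
  qed
  moreover have "complex_of_real a \<noteq> of_real (lam n)" if "p n \<noteq> 0" for n
    using reg[OF that] by simp
  hence "\<forall>\<^sub>F z in at (of_real a). z \<in> - (\<lambda>n. complex_of_real (lam n)) ` {n. p n \<noteq> 0}"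
    using closed_poles by (intro eventually_at_in_open') blast+
  hence "\<forall>\<^sub>F z in at (complex_of_real a). \<forall>n. p n \<noteq> 0 \<longrightarrow> z \<noteq> of_real (lam n)"
    by eventually_elim auto
  hence "\<forall>\<^sub>F z in at (of_real a). perturb_det \<alpha> p z = (z - of_real a) * u z"
    by eventually_elim (use \<open>\<And>z. (\<And>n. p n \<noteq> 0 \<Longrightarrow> z \<noteq> of_real (lam n)) \<Longrightarrow> perturb_det \<alpha> p z = (z - of_real a) * u z\<close> in blast)
  ultimately show ?thesis
    using that[of u] True by simp
qed

text \<open>Justifies the three values of \<open>det_order\<close>: a pole of nonzero weight is
  simple, and otherwise \<open>perturb_det_local_regular\<close> applies to the sum without the term
  at \<open>a\<close>.\<close>

lemma perturb_det_local:
  assumes p: "p summable_on UNIV" "\<And>n. 0 \<le> p n"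
  obtains u where "u analytic_on {of_real a}" "u (of_real a) \<noteq> 0"
    "\<forall>\<^sub>F z in at (of_real a). perturb_det \<alpha> p z = (z - of_real a) powi det_order \<alpha> p a * u z"
proof (cases "\<exists>m. lam m = a")
  case False
  from perturb_det_local_regular[OF p, of a \<alpha>] False
  obtain u where "u analytic_on {of_real a}" "u (of_real a) \<noteq> 0"
    "\<forall>\<^sub>F z in at (of_real a). perturb_det \<alpha> p z =
       (if perturb_det \<alpha> p (of_real a) = 0 then z - of_real a else 1) * u z"
    by blast
  thus ?thesis
    using that[of u] False by (cases "perturb_det \<alpha> p (of_real a) = 0") (simp_all add: det_order_def)
next
  case True
  then obtain m where m: "lam m = a" by blast
  define q where "q = p(m := 0)"
  have q: "q summable_on UNIV" "\<And>n. 0 \<le> q n"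
    using p summable_on_fun_upd_0[OF p] by (auto simp: q_def)
  have qreg: "q n \<noteq> 0 \<Longrightarrow> lam n \<noteq> a" for n using m by (auto simp: q_def)
  have split: "perturb_det \<alpha> p z = perturb_det \<alpha> q z + of_real (\<alpha> * p m) / (of_real a - z)" for z
    using perturb_det_split[OF p, of \<alpha> z m] m by (simp add: q_def)
  show ?thesis
  proof (cases "\<alpha> * p m = 0")
    case True
    hence eq: "perturb_det \<alpha> p = perturb_det \<alpha> q" using split by (simp add: fun_eq_iff)
    from perturb_det_local_regular[OF q, of a \<alpha>] qreg
    obtain u where "u analytic_on {of_real a}" "u (of_real a) \<noteq> 0"
      "\<forall>\<^sub>F z in at (of_real a). perturb_det \<alpha> q z =
         (if perturb_det \<alpha> q (of_real a) = 0 then z - of_real a else 1) * u z"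
      by blast
    moreover have "det_order \<alpha> p a = (if perturb_det \<alpha> q (of_real a) = 0 then 1 else 0)"
      using True m by (auto simp: det_order_def eq)
    ultimately show ?thesis
      using that[of u] by (cases "perturb_det \<alpha> q (of_real a) = 0") (simp_all add: eq)
  next
    case False
    \<comment> \<open>This is (z - a) F(z) with the pole cancelled; at \<open>a\<close> it takes the
      nonzero value \<open>- (\<alpha> * p m)\<close>.\<close>
    define u where "u z = (z - of_real a) * perturb_det \<alpha> q z - of_real (\<alpha> * p m)" for z
    have "pole_sum (\<lambda>n. of_real (q n)) analytic_on {of_real a}"
      by (rule pole_sum_analytic) (use q qreg in auto)
    hence "u analytic_on {of_real a}"
      unfolding perturb_det_def u_def[abs_def] by (intro analytic_intros)
    moreover have "u (of_real a) \<noteq> 0" using False by (simp add: u_def)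
    moreover have "\<forall>\<^sub>F z in at (complex_of_real a). z \<noteq> of_real a"
      by (simp add: eventually_at_filter)
    hence "\<forall>\<^sub>F z in at (of_real a). perturb_det \<alpha> p z = (z - of_real a) powi (-1) * u z"
      by eventually_elim (simp add: split u_def divide_simps, simp add: algebra_simps)
    moreover have "det_order \<alpha> p a = -1" using False m by (auto simp: det_order_def)
    ultimately show ?thesis using that[of u] by simp
  qed
qed

text \<open>On the real axis the equal orders cancel, and off it both determinants are nonzero.
  Hence every singularity of the quotient is removable with a nonzero value.\<close>

lemma perturb_det_ratio_local:
  assumes p: "p summable_on UNIV" "\<And>n. 0 \<le> p n" and q: "q summable_on UNIV" "\<And>n. 0 \<le> q n"
    and ord: "\<And>a. det_order \<alpha> p a = det_order \<beta> q a"
  obtains u where "u analytic_on {z}" "u z \<noteq> 0"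
    "\<forall>\<^sub>F w in at z. perturb_det \<alpha> p w / perturb_det \<beta> q w = u w"
proof (cases "z \<in> \<real>")
  case True
  then obtain a where a: "z = of_real a" by (auto elim: Reals_cases)
  obtain u where u: "u analytic_on {z}" "u z \<noteq> 0"
    "\<forall>\<^sub>F w in at z. perturb_det \<alpha> p w = (w - z) powi det_order \<alpha> p a * u w"
    using perturb_det_local[OF p, of a \<alpha>] a by auto
  obtain v where v: "v analytic_on {z}" "v z \<noteq> 0"
    "\<forall>\<^sub>F w in at z. perturb_det \<beta> q w = (w - z) powi det_order \<beta> q a * v w"
    using perturb_det_local[OF q, of a \<beta>] a by auto
  have "\<forall>\<^sub>F w in at z. w \<noteq> z" by (simp add: eventually_at_filter)
  hence "\<forall>\<^sub>F w in at z. perturb_det \<alpha> p w / perturb_det \<beta> q w = u w / v w"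
    using u(3) v(3) by eventually_elim (simp add: ord)
  thus ?thesis using that[of "\<lambda>w. u w / v w"] u v by (auto intro!: analytic_intros)
next
  case False
  have "perturb_det \<alpha> p z \<noteq> 0" "perturb_det \<beta> q z \<noteq> 0"
    using perturb_det_off_axis[OF p False, of \<alpha>] perturb_det_off_axis[OF q False, of \<beta>] by auto
  thus ?thesis
    using that[of "\<lambda>w. perturb_det \<alpha> p w / perturb_det \<beta> q w"] perturb_det_analytic p q False
    by (auto intro!: analytic_intros)
qed

section \<open>Determinants with equal orders coincide\<close>

lemma Im_log_ratio_bounded:
  assumes "connected S" and g: "continuous_on S g" and f: "continuous_on S f" "continuous_on S h"
    and nonpos: "\<And>z. z \<in> S \<Longrightarrow> f z \<notin> \<real>\<^sub>\<le>\<^sub>0" "\<And>z. z \<in> S \<Longrightarrow> h z \<notin> \<real>\<^sub>\<le>\<^sub>0"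
    and exp_g: "\<And>z. z \<in> S \<Longrightarrow> exp (g z) = f z / h z"
  shows "\<exists>C. \<forall>z\<in>S. \<bar>Im (g z)\<bar> \<le> C"
proof -
  \<comment> \<open>The integer, in units of \<open>2 * pi * \<i>\<close>, by which \<open>g\<close>
    differs from the difference of principal logarithms. It is continuous on the connected set
    \<open>S\<close>, hence constant, and each principal logarithm has imaginary part at most pi in
    absolute value.\<close>
  define k where "k z = (g z - (Ln (f z) - Ln (h z))) / (2 * of_real pi * \<i>)" for z
  have k: "k z \<in> \<int>" if "z \<in> S" for z
  proof -
    have "f z \<noteq> 0" "h z \<noteq> 0" using nonpos[OF that] by auto
    hence "exp (g z) = exp (Ln (f z) - Ln (h z))" using exp_g[OF that] by (simp add: exp_diff)
    then obtain n :: int where "g z = Ln (f z) - Ln (h z) + (of_int (2 * n) * pi) * \<i>"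
      by (auto simp: exp_eq)
    hence "k z = of_int n" by (simp add: k_def)
    thus ?thesis by simp
  qed
  have "k constant_on S"
  proof (rule continuous_discrete_range_constant[OF \<open>connected S\<close>])
    show "continuous_on S k"
      unfolding k_def by (intro continuous_intros g f) (use nonpos in auto)
    show "\<exists>e>0. \<forall>y. y \<in> S \<and> k y \<noteq> k x \<longrightarrow> e \<le> norm (k y - k x)" if "x \<in> S" for x
    proof (intro exI[of _ 1] conjI allI impI)
      fix y assume y: "y \<in> S \<and> k y \<noteq> k x"
      hence "k y - k x \<in> \<int>" "k y - k x \<noteq> 0" using k that by auto
      then obtain j :: int where "k y - k x = of_int j" "j \<noteq> 0" by (metis Ints_cases of_int_0)
      moreover have "1 \<le> \<bar>j\<bar>" using \<open>j \<noteq> 0\<close> by linarith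
      ultimately show "1 \<le> norm (k y - k x)"
        by (metis norm_of_int of_int_1_le_iff of_int_abs)
    qed simp
  qed
  then obtain c where c: "\<And>z. z \<in> S \<Longrightarrow> k z = c" by (auto simp: constant_on_def)
  have "\<bar>Im (g z)\<bar> \<le> norm (c * (2 * of_real pi * \<i>)) + pi + pi" if "z \<in> S" for z
  proof -
    have "g z = c * (2 * of_real pi * \<i>) + (Ln (f z) - Ln (h z))"
      using c[OF that] by (auto simp: k_def)
    hence "Im (g z) = Im (c * (2 * of_real pi * \<i>)) + Im (Ln (f z)) - Im (Ln (h z))"
      by (metis (no_types) add_diff_eq minus_complex.sel(2) plus_complex.sel(2))
    moreover have "f z \<noteq> 0" "h z \<noteq> 0" using nonpos[OF that] by auto
    hence "\<bar>Im (Ln (f z))\<bar> \<le> pi" "\<bar>Im (Ln (h z))\<bar> \<le> pi"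
      using Im_Ln_le_pi[of "f z"] mpi_less_Im_Ln[of "f z"] Im_Ln_le_pi[of "h z"] mpi_less_Im_Ln[of "h z"]
      by (auto simp: abs_le_iff)
    ultimately show ?thesis using abs_Im_le_cmod[of "c * (2 * of_real pi * \<i>)"] by linarith
  qed
  thus ?thesis by blast
qed

lemma not_Reals_iff_Im: "z \<notin> \<real> \<longleftrightarrow> Im z > 0 \<or> Im z < 0"
  using complex_is_Real_iff[of z] by auto

theorem perturb_det_unique:
  assumes p: "p summable_on UNIV" "\<And>n. 0 \<le> p n" and q: "q summable_on UNIV" "\<And>n. 0 \<le> q n"
    and ord: "\<And>a. det_order \<alpha> p a = det_order \<beta> q a"
    and z: "z \<notin> \<real>"
  shows "perturb_det \<alpha> p z = perturb_det \<beta> q z"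
proof -
  define R where "R w = perturb_det \<alpha> p w / perturb_det \<beta> q w" for w
  \<comment> \<open>At real points \<open>R\<close> may carry arbitrary values produced by division
    by zero; removing the singularities turns it into an entire function.\<close>
  define G where "G = remove_sings R"
  have G: "G analytic_on {w}" "G w \<noteq> 0" for w
  proof -
    obtain u where u: "u analytic_on {w}" "u w \<noteq> 0" "\<forall>\<^sub>F y in at w. R y = u y"
      using perturb_det_ratio_local[OF p q ord] unfolding R_def by blast
    have "isolated_singularity_at u w"
      using u(1) isolated_singularity_at_analytic by blast
    hence "isolated_singularity_at R w"
      using isolated_singularity_at_cong[OF u(3)] by blast
    moreover have "u \<midarrow>w\<rightarrow> u w"
      using u(1) analytic_at_imp_isCont isContD by blast
    hence "R \<midarrow>w\<rightarrow> u w" using tendsto_cong[OF u(3)] by blast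
    ultimately show "G analytic_on {w}" "G w \<noteq> 0"
      using u(2) remove_sings_analytic_at[of R w "u w"] remove_sings_eqI[where f = R and z = w and c = "u w"]
      by (simp_all add: G_def)
  qed
  have off: "perturb_det \<alpha> p w \<notin> \<real>\<^sub>\<le>\<^sub>0" "perturb_det \<beta> q w \<notin> \<real>\<^sub>\<le>\<^sub>0" if "w \<notin> \<real>" for w
    using perturb_det_off_axis p q that by blast+
  have an: "perturb_det \<alpha> p analytic_on {w}" "perturb_det \<beta> q analytic_on {w}" if "w \<notin> \<real>" for w
    using perturb_det_analytic p q that by blast+
  have GR: "G w = R w" if "w \<notin> \<real>" for w
    unfolding G_def by (rule remove_sings_at_analytic)
      (use an[OF that] off[OF that] in \<open>auto simp: R_def[abs_def] intro!: analytic_intros\<close>)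
  have "G holomorphic_on UNIV"
    by (intro analytic_imp_holomorphic) (use G(1) analytic_on_analytic_at in blast)
  then obtain g where g: "g holomorphic_on UNIV" "\<And>w. exp (g w) = G w"
    using holomorphic_logarithm_exists[of UNIV G] G(2) by auto
  have cont_g: "continuous_on A g" for A
    using g(1) continuous_on_subset holomorphic_on_imp_continuous_on by blast
  \<comment> \<open>The half-planes are treated separately: the principal logarithms are known to be
    continuous only off the real axis, and the integer ambiguity may differ between the two
    sides.\<close>
  have bd: "\<exists>C. \<forall>w\<in>S. \<bar>Im (g w)\<bar> \<le> C" if S: "connected S" "S \<inter> \<real> = {}" for S
  proof (rule Im_log_ratio_bounded[OF S(1) cont_g])
    show "continuous_on S (perturb_det \<alpha> p)" "continuous_on S (perturb_det \<beta> q)"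
      by (rule continuous_at_imp_continuous_on; use S an analytic_at_imp_isCont in blast)+
    show "exp (g w) = perturb_det \<alpha> p w / perturb_det \<beta> q w" if "w \<in> S" for w
      using g(2) GR[of w] that S(2) by (auto simp: R_def)
  qed (use off S in blast)+
  have halfplanes: "connected {w. Im w > 0}" "connected {w. Im w < 0}"
    "{w. Im w > 0} \<inter> \<real> = {}" "{w. Im w < 0} \<inter> \<real> = {}"
    by (auto intro!: convex_connected convex_halfspace_Im_gt convex_halfspace_Im_lt simp: complex_is_Real_iff)
  obtain C1 where C1: "\<forall>w\<in>{w. Im w > 0}. \<bar>Im (g w)\<bar> \<le> C1"
    using bd[OF halfplanes(1,3)] by blast
  obtain C2 where C2: "\<forall>w\<in>{w. Im w < 0}. \<bar>Im (g w)\<bar> \<le> C2"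
    using bd[OF halfplanes(2,4)] by blast
  define C where "C = max C1 C2"
  have C: "\<bar>Im (g w)\<bar> \<le> C" for w
  proof (cases "w \<in> \<real>")
    case False
    hence "\<bar>Im (g w)\<bar> \<le> C1 \<or> \<bar>Im (g w)\<bar> \<le> C2" using C1 C2 by (auto simp: not_Reals_iff_Im)
    thus ?thesis by (auto simp: C_def)
  next
    case True
    \<comment> \<open>A real point is approached from the upper half-plane, and the bound passes to
      the limit by continuity of \<open>g\<close>.\<close>
    have "((\<lambda>t. w + of_real t * \<i>) \<longlongrightarrow> w + of_real 0 * \<i>) (at_right 0)"
      by (intro tendsto_intros)
    moreover have "isCont g w" using cont_g[of UNIV] by (simp add: continuous_on_eq_continuous_at)
    ultimately have "((\<lambda>t. g (w + of_real t * \<i>)) \<longlongrightarrow> g w) (at_right 0)"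
      using isCont_tendsto_compose[of w g] by simp
    hence "((\<lambda>t. \<bar>Im (g (w + of_real t * \<i>))\<bar>) \<longlongrightarrow> \<bar>Im (g w)\<bar>) (at_right 0)"
      by (intro tendsto_intros)
    moreover have "\<forall>\<^sub>F t in at_right 0. \<bar>Im (g (w + of_real t * \<i>))\<bar> \<le> C"
    proof (rule eventually_mono[OF eventually_at_right_less])
      fix t :: real assume "0 < t"
      hence "Im (w + of_real t * \<i>) > 0" using True by (auto simp: complex_is_Real_iff)
      hence "\<bar>Im (g (w + of_real t * \<i>))\<bar> \<le> C1" using C1 by blast
      thus "\<bar>Im (g (w + of_real t * \<i>))\<bar> \<le> C" by (simp add: C_def)
    qed
    ultimately show ?thesis by (rule tendsto_upperbound) simp
  qed
  \<comment> \<open>Two points with imaginary part above the bound are omitted values of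
    \<open>g\<close>; little Picard then makes \<open>g\<close> constant.\<close>
  have "range g \<inter> {\<i> * of_real (C + 1), \<i> * of_real (C + 2)} = {}"
  proof (rule equals0I)
    fix y assume "y \<in> range g \<inter> {\<i> * of_real (C + 1), \<i> * of_real (C + 2)}"
    then obtain w where "g w = \<i> * of_real (C + 1) \<or> g w = \<i> * of_real (C + 2)" by auto
    hence "Im (g w) = C + 1 \<or> Im (g w) = C + 2" by auto
    thus False using C[of w] by linarith
  qed
  moreover have "\<i> * complex_of_real (C + 1) \<noteq> \<i> * complex_of_real (C + 2)"
    by (simp add: complex_eq_iff)
  ultimately obtain c where c: "g = (\<lambda>w. c)"
    using little_Picard[OF g(1)] by blast
  define \<gamma> where "\<gamma> = exp c"
  have ratio: "perturb_det \<alpha> p w = \<gamma> * perturb_det \<beta> q w" if "w \<notin> \<real>" for w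
    using g(2)[of w] GR[OF that] off[OF that] c by (auto simp: R_def \<gamma>_def field_simps)
  have lim: "((\<lambda>t. perturb_det \<alpha> p (of_real t * \<i>)) \<longlongrightarrow> 1) at_top"
    if p: "p summable_on UNIV" "\<And>n. 0 \<le> p n" for \<alpha> p
  proof (rule Lim_null_comparison[THEN LIM_zero_cancel])
    show "\<forall>\<^sub>F t in at_top. norm (perturb_det \<alpha> p (of_real t * \<i>) - 1) \<le> \<bar>\<alpha>\<bar> * (\<Sum>\<^sub>\<infinity>n. p n) / t"
      using eventually_gt_at_top[of 0]
    proof eventually_elim
      case (elim t)
      show ?case using perturb_det_asymp[OF p, of "of_real t * \<i>" \<alpha>] elim by (simp add: complex_is_Real_iff)
    qed
    show "((\<lambda>t. \<bar>\<alpha>\<bar> * (\<Sum>\<^sub>\<infinity>n. p n) / t) \<longlongrightarrow> 0) at_top"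
      by (intro tendsto_divide_0[OF tendsto_const] filterlim_at_top_imp_at_infinity filterlim_ident)
  qed
  have "((\<lambda>t. \<gamma> * perturb_det \<beta> q (of_real t * \<i>)) \<longlongrightarrow> \<gamma> * 1) at_top"
    by (intro tendsto_intros lim q)
  moreover have "\<forall>\<^sub>F t in at_top. \<gamma> * perturb_det \<beta> q (of_real t * \<i>) = perturb_det \<alpha> p (of_real t * \<i>)"
    using eventually_gt_at_top[of 0] by eventually_elim (simp add: ratio complex_is_Real_iff)
  ultimately have "((\<lambda>t. perturb_det \<alpha> p (of_real t * \<i>)) \<longlongrightarrow> \<gamma> * 1) at_top"
    by (rule Lim_transform_eventually)
  from tendsto_unique[OF _ this lim[OF p]] have "\<gamma> = 1" by simp
  thus ?thesis using ratio[OF z] by simp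
qed

section \<open>Weights as residues\<close>

lemma perturb_det_residue:
  assumes p: "p summable_on UNIV" "\<And>n. 0 \<le> p n"
  shows "((\<lambda>t. - (of_real t * \<i>) * perturb_det \<alpha> p (of_real (lam m) + of_real t * \<i>)) \<longlongrightarrow> of_real (\<alpha> * p m)) (at_right 0)"
proof -
  define q where "q = p(m := 0)"
  have q: "q summable_on UNIV" "\<And>n. 0 \<le> q n" "q m = 0"
    using p summable_on_fun_upd_0[OF p] by (auto simp: q_def)
  have "pole_sum (\<lambda>n. of_real (q n)) analytic_on {of_real (lam m)}"
    by (rule pole_sum_analytic) (use q in auto)
  hence "perturb_det \<alpha> q analytic_on {of_real (lam m)}"
    unfolding perturb_det_def[abs_def] by (intro analytic_intros)
  hence ct: "isCont (perturb_det \<alpha> q) (of_real (lam m))" by (rule analytic_at_imp_isCont)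
  define w where "w t = complex_of_real (lam m) + of_real t * \<i>" for t
  have "(w \<longlongrightarrow> of_real (lam m) + of_real 0 * \<i>) (at_right 0)"
    unfolding w_def by (intro tendsto_intros)
  hence "(w \<longlongrightarrow> of_real (lam m)) (at_right 0)" by simp
  hence lim: "((\<lambda>t. perturb_det \<alpha> q (w t)) \<longlongrightarrow> perturb_det \<alpha> q (of_real (lam m))) (at_right 0)"
    by (rule isCont_tendsto_compose[OF ct])
  have "((\<lambda>t. - (of_real t * \<i>) * perturb_det \<alpha> q (w t) + of_real (\<alpha> * p m))
     \<longlongrightarrow> - (of_real 0 * \<i>) * perturb_det \<alpha> q (of_real (lam m)) + of_real (\<alpha> * p m)) (at_right 0)"
    by (intro tendsto_intros lim)
  moreover have "\<forall>\<^sub>F t in at_right 0. - (of_real t * \<i>) * perturb_det \<alpha> q (w t) + of_real (\<alpha> * p m)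
      = - (of_real t * \<i>) * perturb_det \<alpha> p (w t)"
  proof (rule eventually_mono[OF eventually_at_right_less])
    fix t :: real assume "0 < t"
    \<comment> \<open>On the vertical line \<open>lam m - w t\<close> equals
      \<open>- (of_real t * \<i>)\<close>, so the split-off term contributes exactly
      \<open>\<alpha> * p m\<close>, while the regular part is multiplied by a factor tending to
      0.\<close>
    hence "- (of_real t * \<i>) * (of_real (\<alpha> * p m) / (of_real (lam m) - w t)) = of_real (\<alpha> * p m)"
      by (simp add: w_def)
    thus "- (of_real t * \<i>) * perturb_det \<alpha> q (w t) + of_real (\<alpha> * p m)
      = - (of_real t * \<i>) * perturb_det \<alpha> p (w t)"
      unfolding perturb_det_split[OF p, of \<alpha> "w t" m, folded q_def] distrib_left by simp
  qed
  ultimately have "((\<lambda>t. - (of_real t * \<i>) * perturb_det \<alpha> p (w t))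
     \<longlongrightarrow> - (of_real 0 * \<i>) * perturb_det \<alpha> q (of_real (lam m)) + of_real (\<alpha> * p m)) (at_right 0)"
    by (rule Lim_transform_eventually)
  thus ?thesis by (simp add: w_def)
qed

theorem perturb_det_order_unique:
  assumes p: "p summable_on UNIV" "\<And>n. 0 \<le> p n" and q: "q summable_on UNIV" "\<And>n. 0 \<le> q n"
    and ord: "\<And>a. det_order \<alpha> p a = det_order \<beta> q a"
  shows "\<alpha> * p m = \<beta> * q m"
proof -
  let ?f = "\<lambda>\<alpha> p t. - (of_real t * \<i>) * perturb_det \<alpha> p (of_real (lam m) + of_real t * \<i>)"
  have "\<forall>\<^sub>F t in at_right 0. ?f \<beta> q t = ?f \<alpha> p t"
  proof (rule eventually_mono[OF eventually_at_right_less])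
    fix t :: real assume "0 < t"
    hence "of_real (lam m) + of_real t * \<i> \<notin> \<real>" by (simp add: complex_is_Real_iff)
    thus "?f \<beta> q t = ?f \<alpha> p t" using perturb_det_unique[OF p q ord] by simp
  qed
  with perturb_det_residue[OF q] have "(?f \<alpha> p \<longlongrightarrow> of_real (\<beta> * q m)) (at_right 0)"
    by (rule Lim_transform_eventually)
  moreover have "(?f \<alpha> p \<longlongrightarrow> of_real (\<alpha> * p m)) (at_right 0)"
    by (rule perturb_det_residue[OF p])
  ultimately have "complex_of_real (\<beta> * q m) = of_real (\<alpha> * p m)"
    by (intro tendsto_unique[of "at_right (0::real)"]) auto
  thus ?thesis unfolding of_real_eq_iff by (rule sym)
qed

end

subsection \<open>Square-integrable functions\<close>

text \<open>The squared norm keeps the identities of Bessel and Parseval free of roots.\<close>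

definition L2_sqnorm :: "(real \<Rightarrow> complex) \<Rightarrow> real" where
  "L2_sqnorm f = (LINT x|leb01. (cmod (f x))\<^sup>2)"

lemma L2_norm_eq_sqrt: "L2_norm f = sqrt (L2_sqnorm f)"
  by (simp add: L2_norm_def L2_sqnorm_def)

lemma L2_sqnorm_nonneg [simp]: "0 \<le> L2_sqnorm f"
  by (simp add: L2_sqnorm_def)

lemma finite_measure_leb01: "finite_measure leb01"
  by (rule finite_measure_lebesgue_on) (simp add: lmeasurable_interval)

lemma measurable_L2 [measurable_dest]: "f \<in> L2 \<Longrightarrow> f \<in> borel_measurable leb01"
  by (simp add: L2_def)

lemma integrable_sq_L2: "f \<in> L2 \<Longrightarrow> integrable leb01 (\<lambda>x. (cmod (f x))\<^sup>2)"
  by (simp add: L2_def)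

lemma L2_dominated:
  assumes "f \<in> borel_measurable leb01" "integrable leb01 w"
    "\<And>x. x \<in> {0..1} \<Longrightarrow> (cmod (f x))\<^sup>2 \<le> w x"
  shows "f \<in> L2"
proof -
  note [measurable] = assms(1)
  have "integrable leb01 (\<lambda>x. (cmod (f x))\<^sup>2)"
    by (rule Bochner_Integration.integrable_bound[OF assms(2)])
       (use assms(3) in \<open>auto intro!: AE_I2 intro: order.trans[OF _ abs_ge_self]\<close>)
  thus ?thesis using assms(1) by (simp add: L2_def)
qed

text \<open>Takes the place of the triangle inequality for squared norms; the factor 2 is harmless
  where only integrability or convergence to 0 is at stake.\<close>

lemma norm_add_sq_le:
  fixes a b :: "'a::real_normed_vector"
  shows "(norm (a + b))\<^sup>2 \<le> 2 * (norm a)\<^sup>2 + 2 * (norm b)\<^sup>2"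
proof -
  have "(norm (a + b))\<^sup>2 \<le> (norm a + norm b)\<^sup>2"
    by (intro power_mono norm_triangle_ineq) auto
  also have "\<dots> \<le> 2 * (norm a)\<^sup>2 + 2 * (norm b)\<^sup>2"
    using sum_squares_bound[of "norm a" "norm b"] by (simp add: power2_sum)
  finally show ?thesis .
qed

lemma L2_add:
  assumes [measurable]: "f \<in> L2" "g \<in> L2"
  shows "(\<lambda>x. f x + g x) \<in> L2"
proof (rule L2_dominated)
  show "integrable leb01 (\<lambda>x. 2 * (cmod (f x))\<^sup>2 + 2 * (cmod (g x))\<^sup>2)"
    using assms by (auto simp: integrable_sq_L2)
qed (auto intro: norm_add_sq_le)

lemma L2_cmult: "f \<in> L2 \<Longrightarrow> (\<lambda>x. c * f x) \<in> L2"
  by (auto simp: L2_def norm_mult power_mult_distrib)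

lemma L2_cmult': "f \<in> L2 \<Longrightarrow> (\<lambda>x. f x * c) \<in> L2"
  using L2_cmult[of f c] by (simp add: mult.commute)

lemma L2_diff: "f \<in> L2 \<Longrightarrow> g \<in> L2 \<Longrightarrow> (\<lambda>x. f x - g x) \<in> L2"
  using L2_add[of f "\<lambda>x. (-1) * g x"] L2_cmult[of g "-1"] by simp

lemma L2_bounded:
  assumes "f \<in> borel_measurable leb01" "\<And>x. x \<in> {0..1} \<Longrightarrow> cmod (f x) \<le> B"
  shows "f \<in> L2"
proof (rule L2_dominated[OF assms(1)])
  show "integrable leb01 (\<lambda>x. B\<^sup>2)"
    using finite_measure.integrable_const[OF finite_measure_leb01] by blast
  show "(cmod (f x))\<^sup>2 \<le> B\<^sup>2" if "x \<in> {0..1}" for x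
    using assms(2)[OF that] by (intro power_mono) auto
qed

lemma L2_continuous:
  assumes "continuous_on {0..1} f"
  shows "f \<in> L2"
proof -
  have "bounded (f ` {0..1})"
    using assms compact_continuous_image compact_imp_bounded by blast
  then obtain B where "\<forall>y\<in>f ` {0..1}. cmod y \<le> B" unfolding bounded_iff by blast
  thus ?thesis
    using continuous_imp_measurable_on_sets_lebesgue[OF assms] by (intro L2_bounded) auto
qed

lemma L2_zero [simp]: "(\<lambda>x. 0) \<in> L2"
  by (rule L2_continuous) simp

lemma L2_sum: "(\<And>i. i \<in> I \<Longrightarrow> f i \<in> L2) \<Longrightarrow> (\<lambda>x. \<Sum>i\<in>I. f i x) \<in> L2"
  by (induction I rule: infinite_finite_induct) (auto intro: L2_add)

lemma L2_cong_AE: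
  assumes "f \<in> L2" "AE x in leb01. f x = g x" "g \<in> borel_measurable leb01"
  shows "g \<in> L2"
proof -
  note [measurable] = measurable_L2[OF assms(1)] assms(3)
  have "integrable leb01 (\<lambda>x. (cmod (f x))\<^sup>2) \<longleftrightarrow> integrable leb01 (\<lambda>x. (cmod (g x))\<^sup>2)"
    by (rule integrable_cong_AE) (use assms(2) in auto)
  thus ?thesis using assms by (simp add: L2_def)
qed

lemma borel_measurable_cnj [measurable (raw)]:
  "f \<in> borel_measurable M \<Longrightarrow> (\<lambda>x. cnj (f x)) \<in> borel_measurable M"
  by (rule measurable_compose[OF _ borel_measurable_continuous_onI]) (auto intro: continuous_intros)

lemma integrable_L2_mult:
  assumes [measurable]: "f \<in> L2" "g \<in> L2"
  shows "integrable leb01 (\<lambda>x. f x * cnj (g x))"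
proof (rule Bochner_Integration.integrable_bound)
  show "integrable leb01 (\<lambda>x. (cmod (f x))\<^sup>2 + (cmod (g x))\<^sup>2)"
    using assms by (auto simp: integrable_sq_L2)
  have "cmod (f x * cnj (g x)) \<le> (cmod (f x))\<^sup>2 + (cmod (g x))\<^sup>2" for x
    using sum_squares_bound[of "cmod (f x)" "cmod (g x)"] mult_nonneg_nonneg[of "cmod (f x)" "cmod (g x)"]
    by (simp add: norm_mult del: mult_nonneg_nonneg)
  thus "AE x in leb01. cmod (f x * cnj (g x)) \<le> norm ((cmod (f x))\<^sup>2 + (cmod (g x))\<^sup>2)"
    by (simp del: norm_mult)
qed simp

lemma integrable_L2: "f \<in> L2 \<Longrightarrow> integrable leb01 f"
  using integrable_L2_mult[of f "\<lambda>x. 1"] L2_continuous[of "\<lambda>x. 1"] by simp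

lemma L2_inner_add_left:
  "f \<in> L2 \<Longrightarrow> g \<in> L2 \<Longrightarrow> h \<in> L2 \<Longrightarrow> L2_inner (\<lambda>x. f x + g x) h = L2_inner f h + L2_inner g h"
  unfolding L2_inner_def by (simp add: distrib_right integrable_L2_mult)

lemma L2_inner_cmult_left: "L2_inner (\<lambda>x. c * f x) h = c * L2_inner f h"
  unfolding L2_inner_def by (simp add: mult.assoc)

lemma L2_inner_zero_left [simp]: "L2_inner (\<lambda>x. 0) h = 0"
  unfolding L2_inner_def by simp

lemma L2_inner_cnj: "L2_inner g f = cnj (L2_inner f g)"
  unfolding L2_inner_def using Bochner_Integration.integral_cnj[of leb01 "\<lambda>x. f x * cnj (g x)"] by (simp add: mult.commute)

lemma L2_inner_diff_left:
  "f \<in> L2 \<Longrightarrow> g \<in> L2 \<Longrightarrow> h \<in> L2 \<Longrightarrow> L2_inner (\<lambda>x. f x - g x) h = L2_inner f h - L2_inner g h"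
  using L2_inner_add_left[of f "\<lambda>x. (-1) * g x" h] L2_cmult[of g "-1"] L2_inner_cmult_left[of "-1" g h]
  by simp

lemma L2_inner_sum_left:
  "(\<And>i. i \<in> I \<Longrightarrow> f i \<in> L2) \<Longrightarrow> h \<in> L2 \<Longrightarrow> L2_inner (\<lambda>x. \<Sum>i\<in>I. f i x) h = (\<Sum>i\<in>I. L2_inner (f i) h)"
  by (induction I rule: infinite_finite_induct) (auto simp: L2_inner_add_left L2_sum)

lemma L2_inner_diff_right:
  "f \<in> L2 \<Longrightarrow> g \<in> L2 \<Longrightarrow> h \<in> L2 \<Longrightarrow> L2_inner h (\<lambda>x. f x - g x) = L2_inner h f - L2_inner h g"
  by (subst (1 2 3) L2_inner_cnj) (simp add: L2_inner_diff_left)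

lemma L2_inner_self: "L2_inner f f = of_real (L2_sqnorm f)"
  unfolding L2_inner_def L2_sqnorm_def
  by (subst integral_complex_of_real[symmetric]) (simp add: complex_norm_square[symmetric])

lemma L2_inner_cong_AE:
  assumes "AE x in leb01. f x = g x" "f \<in> borel_measurable leb01" "g \<in> borel_measurable leb01" "h \<in> L2"
  shows "L2_inner f h = L2_inner g h"
proof -
  note [measurable] = assms(2,3) measurable_L2[OF assms(4)]
  show ?thesis unfolding L2_inner_def
    by (rule integral_cong_AE) (use assms(1) in auto)
qed

lemma L2_sqnorm_cong_AE:
  assumes "AE x in leb01. f x = g x" "f \<in> borel_measurable leb01" "g \<in> borel_measurable leb01"
  shows "L2_sqnorm f = L2_sqnorm g"
proof -
  note [measurable] = assms(2,3)
  show ?thesis unfolding L2_sqnorm_def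
    by (rule integral_cong_AE) (use assms(1) in auto)
qed

lemma L2_sqnorm_cmult: "L2_sqnorm (\<lambda>x. c * f x) = (cmod c)\<^sup>2 * L2_sqnorm f"
  unfolding L2_sqnorm_def by (simp add: norm_mult power_mult_distrib)

lemma L2_sqnorm_add_le:
  assumes "f \<in> L2" "g \<in> L2"
  shows "L2_sqnorm (\<lambda>x. f x + g x) \<le> 2 * L2_sqnorm f + 2 * L2_sqnorm g"
proof -
  have "L2_sqnorm (\<lambda>x. f x + g x) \<le> (LINT x|leb01. 2 * (cmod (f x))\<^sup>2 + 2 * (cmod (g x))\<^sup>2)"
    unfolding L2_sqnorm_def using assms L2_add[OF assms]
    by (intro integral_mono) (auto simp: integrable_sq_L2 intro: norm_add_sq_le)
  also have "\<dots> = 2 * L2_sqnorm f + 2 * L2_sqnorm g"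
    unfolding L2_sqnorm_def using assms by (simp add: integrable_sq_L2)
  finally show ?thesis .
qed

lemma L2_sqnorm_eq_0_iff:
  assumes "f \<in> L2"
  shows "L2_sqnorm f = 0 \<longleftrightarrow> (AE x in leb01. f x = 0)"
  unfolding L2_sqnorm_def using integral_nonneg_eq_0_iff_AE[OF integrable_sq_L2[OF assms]] by simp

subsection \<open>Fourier coefficients\<close>

text \<open>Eigenfunctions of \<open>L_zero\<close>: the third derivative multiplies by (2 pi i
  n)^3, and a further factor i gives the real number (2 pi n)^3.\<close>

definition fexp :: "int \<Rightarrow> real \<Rightarrow> complex" where
  "fexp n x = exp (2 * of_real pi * \<i> * of_int n * of_real x)"

definition fcoef :: "(real \<Rightarrow> complex) \<Rightarrow> int \<Rightarrow> complex" where
  "fcoef f n = L2_inner f (fexp n)"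

lemma norm_fexp [simp]: "cmod (fexp n x) = 1"
  unfolding fexp_def norm_exp_eq_Re by simp

lemma fexp_0 [simp]: "fexp n 0 = 1" "fexp 0 x = 1"
  by (simp_all add: fexp_def)

lemma fexp_1 [simp]: "fexp n 1 = 1"
  using exp_integer_2pi[of "of_int n"] by (simp add: fexp_def mult_ac)

lemma cnj_fexp: "cnj (fexp n x) = fexp (- n) x"
  unfolding fexp_def exp_cnj by simp

lemma fexp_mult: "fexp m x * fexp n x = fexp (m + n) x"
  unfolding fexp_def exp_add[symmetric] by (simp add: algebra_simps)

lemma continuous_fexp [continuous_intros]: "continuous_on A (fexp n)"
  unfolding fexp_def by (intro continuous_intros)

lemma L2_fexp [simp]: "fexp n \<in> L2"
  by (intro L2_continuous continuous_intros)

lemma fexp_has_vector_derivative [derivative_intros]: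
  "(fexp n has_vector_derivative (2 * of_real pi * \<i> * of_int n * fexp n x)) (at x within A)"
proof -
  have "((\<lambda>z. exp (2 * of_real pi * \<i> * of_int n * z)) has_field_derivative
      (2 * of_real pi * \<i> * of_int n * fexp n x)) (at (of_real x))"
    by (auto intro!: derivative_eq_intros simp: fexp_def)
  from has_vector_derivative_real_field[OF this]
  show ?thesis unfolding fexp_def .
qed

lemma lebesgue_on_FTC:
  fixes F :: "real \<Rightarrow> 'a::euclidean_space"
  assumes "a \<le> b" "\<And>x. x \<in> {a..b} \<Longrightarrow> (F has_vector_derivative f x) (at x within {a..b})"
    "continuous_on {a..b} f"
  shows "(LINT x|lebesgue_on {a..b}. f x) = F b - F a"
  using fundamental_theorem_of_calculus[OF assms(1,2)] continuous_imp_integrable_real[OF assms(3)]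
  by (simp add: lebesgue_integral_eq_integral integral_unique)

lemma integral_fexp:
  assumes "n \<noteq> 0" "a \<le> b"
  shows "(LINT x|lebesgue_on {a..b}. fexp n x) = (fexp n b - fexp n a) / (2 * of_real pi * \<i> * of_int n)"
proof -
  have "((\<lambda>x. fexp n x / (2 * of_real pi * \<i> * of_int n)) has_vector_derivative fexp n x) (at x within {a..b})" for x
    using assms(1) by (auto intro!: derivative_eq_intros simp: field_simps)
  from lebesgue_on_FTC[OF assms(2) this] show ?thesis
    by (simp add: continuous_intros diff_divide_distrib)
qed

lemma L2_inner_fexp: "L2_inner (fexp m) (fexp n) = (if m = n then 1 else 0)"
proof (cases "m = n")
  case True
  have "(LINT x|leb01. (1::complex)) = complex_of_real (measure leb01 (space leb01))"
    by (simp add: scaleR_conv_of_real)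
  also have "measure leb01 (space leb01) = 1" by (simp add: measure_restrict_space)
  finally show ?thesis using True by (simp add: L2_inner_def cnj_fexp fexp_mult)
next
  case False
  thus ?thesis using integral_fexp[of "m - n" 0 1] by (simp add: L2_inner_def cnj_fexp fexp_mult)
qed

lemma fcoef_add: "f \<in> L2 \<Longrightarrow> g \<in> L2 \<Longrightarrow> fcoef (\<lambda>x. f x + g x) n = fcoef f n + fcoef g n"
  by (simp add: fcoef_def L2_inner_add_left)

lemma fcoef_diff: "f \<in> L2 \<Longrightarrow> g \<in> L2 \<Longrightarrow> fcoef (\<lambda>x. f x - g x) n = fcoef f n - fcoef g n"
  by (simp add: fcoef_def L2_inner_diff_left)

lemma fcoef_cmult: "fcoef (\<lambda>x. c * f x) n = c * fcoef f n"
  by (simp add: fcoef_def L2_inner_cmult_left)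

lemma fcoef_fexp: "fcoef (fexp m) n = (if m = n then 1 else 0)"
  by (simp add: fcoef_def L2_inner_fexp)

lemma fcoef_cong_AE:
  assumes "AE x in leb01. f x = g x" "f \<in> L2" "g \<in> L2"
  shows "fcoef f n = fcoef g n"
  unfolding fcoef_def using assms by (intro L2_inner_cong_AE) (auto simp: measurable_L2)

section \<open>Bessel's identity and approximation by Fourier sums\<close>

definition fourier_sum :: "int set \<Rightarrow> (real \<Rightarrow> complex) \<Rightarrow> real \<Rightarrow> complex" where
  "fourier_sum I f x = (\<Sum>n\<in>I. fcoef f n * fexp n x)"

lemma L2_fourier_sum [simp]: "fourier_sum I f \<in> L2"
  unfolding fourier_sum_def[abs_def] by (intro L2_sum L2_cmult L2_fexp)

text \<open>The inner products of the Fourier sum S with f, of f with S and of S with itself are all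
  equal to the sum of the squared moduli, so expanding the norm of f - S leaves it once with a minus
  sign.\<close>

lemma bessel_identity:
  assumes f: "f \<in> L2" and "finite I"
  shows "L2_sqnorm (\<lambda>x. f x - fourier_sum I f x) = L2_sqnorm f - (\<Sum>n\<in>I. (cmod (fcoef f n))\<^sup>2)"
proof -
  let ?S = "fourier_sum I f"
  have Sh: "L2_inner ?S h = (\<Sum>n\<in>I. fcoef f n * L2_inner (fexp n) h)" if "h \<in> L2" for h
    unfolding fourier_sum_def[abs_def] using that
    by (simp add: L2_inner_sum_left L2_inner_cmult_left L2_cmult)
  have SF: "L2_inner ?S (fexp n) = fcoef f n" if "n \<in> I" for n
    using Sh[of "fexp n"] that \<open>finite I\<close> by (simp add: L2_inner_fexp if_distrib cong: if_cong)
  have "L2_inner (fexp n) f = cnj (fcoef f n)" for n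
    unfolding fcoef_def by (rule L2_inner_cnj)
  hence 1: "L2_inner ?S f = (\<Sum>n\<in>I. of_real ((cmod (fcoef f n))\<^sup>2))"
    using Sh[OF f] by (simp add: complex_norm_square[symmetric])
  have "L2_inner (fexp n) ?S = cnj (fcoef f n)" if "n \<in> I" for n
    using L2_inner_cnj[of "fexp n" ?S] SF[OF that] by simp
  hence 2: "L2_inner ?S ?S = (\<Sum>n\<in>I. of_real ((cmod (fcoef f n))\<^sup>2))"
    using Sh[of ?S] by (simp add: complex_norm_square[symmetric])
  have 3: "L2_inner f ?S = (\<Sum>n\<in>I. of_real ((cmod (fcoef f n))\<^sup>2))"
    using L2_inner_cnj[of f ?S] 1 by simp
  have "complex_of_real (L2_sqnorm (\<lambda>x. f x - ?S x)) = L2_inner (\<lambda>x. f x - ?S x) (\<lambda>x. f x - ?S x)"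
    by (rule L2_inner_self[symmetric])
  also have "\<dots> = L2_inner f f - (\<Sum>n\<in>I. of_real ((cmod (fcoef f n))\<^sup>2))"
    using f by (simp add: L2_inner_diff_left L2_inner_diff_right L2_diff 1 2 3)
  also have "\<dots> = of_real (L2_sqnorm f - (\<Sum>n\<in>I. (cmod (fcoef f n))\<^sup>2))"
    by (simp add: L2_inner_self)
  finally show ?thesis unfolding of_real_eq_iff .
qed

lemma bessel_ineq:
  assumes "f \<in> L2" "finite I"
  shows "(\<Sum>n\<in>I. (cmod (fcoef f n))\<^sup>2) \<le> L2_sqnorm f"
  using bessel_identity[OF assms] L2_sqnorm_nonneg[of "\<lambda>x. f x - fourier_sum I f x"] by linarith

text \<open>The squared distance of \<open>f\<close> from the span of the exponentials of frequency
  at most \<open>N\<close>. It is subadditive up to a factor 2 and bounded by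
  \<open>L2_sqnorm f\<close>, uniformly in \<open>N\<close>; closure under sums and limits rests on
  these two facts.\<close>

definition fourier_residual :: "(real \<Rightarrow> complex) \<Rightarrow> nat \<Rightarrow> real" where
  "fourier_residual f N = L2_sqnorm (\<lambda>x. f x - fourier_sum {- int N..int N} f x)"

lemma fourier_residual_eq:
  "f \<in> L2 \<Longrightarrow> fourier_residual f N = L2_sqnorm f - (\<Sum>n\<in>{- int N..int N}. (cmod (fcoef f n))\<^sup>2)"
  unfolding fourier_residual_def by (rule bessel_identity) auto

lemma fourier_residual_nonneg [simp]: "0 \<le> fourier_residual f N"
  by (simp add: fourier_residual_def)

lemma fourier_residual_le: "f \<in> L2 \<Longrightarrow> fourier_residual f N \<le> L2_sqnorm f"
  by (simp add: fourier_residual_eq sum_nonneg)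

lemma fourier_residual_add:
  assumes "f \<in> L2" "g \<in> L2"
  shows "fourier_residual (\<lambda>x. f x + g x) N \<le> 2 * fourier_residual f N + 2 * fourier_residual g N"
proof -
  let ?I = "{- int N..int N}"
  have "(\<lambda>x. f x + g x - fourier_sum ?I (\<lambda>x. f x + g x) x) =
      (\<lambda>x. (f x - fourier_sum ?I f x) + (g x - fourier_sum ?I g x))"
    using assms by (simp add: fourier_sum_def fcoef_add distrib_right sum.distrib fun_eq_iff)
  thus ?thesis
    unfolding fourier_residual_def using assms by (simp add: L2_sqnorm_add_le L2_diff)
qed

lemma fourier_residual_cmult:
  "fourier_residual (\<lambda>x. c * f x) N = (cmod c)\<^sup>2 * fourier_residual f N"
proof -
  let ?I = "{- int N..int N}"
  have "(\<lambda>x. c * f x - fourier_sum ?I (\<lambda>x. c * f x) x) = (\<lambda>x. c * (f x - fourier_sum ?I f x))"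
    by (simp add: fourier_sum_def fcoef_cmult algebra_simps sum_distrib_left fun_eq_iff)
  thus ?thesis unfolding fourier_residual_def by (simp add: L2_sqnorm_cmult)
qed

text \<open>A closed subspace of \<open>L2\<close>; to exhaust \<open>L2\<close> it is enough to put
  generators into it.\<close>

definition parseval_set :: "(real \<Rightarrow> complex) set" where
  "parseval_set = {f \<in> L2. fourier_residual f \<longlonglongrightarrow> 0}"

lemma parseval_set_add:
  assumes "f \<in> parseval_set" "g \<in> parseval_set"
  shows "(\<lambda>x. f x + g x) \<in> parseval_set"
proof -
  have "(\<lambda>N. 2 * fourier_residual f N + 2 * fourier_residual g N) \<longlonglongrightarrow> 2 * 0 + 2 * 0"
    using assms by (intro tendsto_intros) (auto simp: parseval_set_def)
  hence lim: "(\<lambda>N. 2 * fourier_residual f N + 2 * fourier_residual g N) \<longlonglongrightarrow> 0" by simp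
  have "\<forall>\<^sub>F N in sequentially. norm (fourier_residual (\<lambda>x. f x + g x) N) \<le>
      2 * fourier_residual f N + 2 * fourier_residual g N"
    using assms fourier_residual_add[of f g] by (simp add: parseval_set_def)
  from Lim_null_comparison[OF this lim] show ?thesis
    using assms by (simp add: parseval_set_def L2_add)
qed

lemma parseval_set_cmult: "f \<in> parseval_set \<Longrightarrow> (\<lambda>x. c * f x) \<in> parseval_set"
  using tendsto_mult_right_zero[of "fourier_residual f" sequentially "(cmod c)\<^sup>2"]
  by (simp add: parseval_set_def L2_cmult fourier_residual_cmult[abs_def])

lemma parseval_set_diff: "f \<in> parseval_set \<Longrightarrow> g \<in> parseval_set \<Longrightarrow> (\<lambda>x. f x - g x) \<in> parseval_set"
  using parseval_set_add[of f "\<lambda>x. (-1) * g x"] parseval_set_cmult[of g "-1"] by simp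

lemma parseval_set_fexp: "fexp m \<in> parseval_set"
proof -
  have "\<forall>\<^sub>F N in sequentially. fourier_residual (fexp m) N = 0"
    using eventually_ge_at_top[of "nat \<bar>m\<bar>"]
  proof eventually_elim
    case (elim N)
    hence m: "m \<in> {- int N..int N}" by auto
    have "L2_sqnorm (fexp m) = 1" by (simp add: L2_sqnorm_def measure_restrict_space)
    moreover have "(\<Sum>n\<in>{- int N..int N}. (cmod (fcoef (fexp m) n))\<^sup>2) = (\<Sum>n\<in>{- int N..int N}. if m = n then 1 else 0)"
      by (intro sum.cong) (auto simp: fcoef_fexp)
    ultimately show ?case using m by (simp add: fourier_residual_eq)
  qed
  thus ?thesis by (simp add: parseval_set_def tendsto_eventually)
qed

lemma parseval_set_const: "(\<lambda>x. c) \<in> parseval_set"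
  using parseval_set_cmult[OF parseval_set_fexp, of c 0] by simp

lemma parseval_set_sum: "(\<And>i. i \<in> I \<Longrightarrow> f i \<in> parseval_set) \<Longrightarrow> (\<lambda>x. \<Sum>i\<in>I. f i x) \<in> parseval_set"
  by (induction I rule: infinite_finite_induct) (auto intro: parseval_set_add parseval_set_const)

text \<open>The residual of f is at most twice that of f - g plus twice that of g. The first is
  small for all N at once when g is close to f, the second for large N; hence the quarters of
  \<open>r\<close>.\<close>

lemma parseval_set_limit:
  assumes "f \<in> L2" "\<And>i. g i \<in> parseval_set" "(\<lambda>i. L2_sqnorm (\<lambda>x. f x - g i x)) \<longlonglongrightarrow> 0"
  shows "f \<in> parseval_set"
proof -
  have "fourier_residual f \<longlonglongrightarrow> 0"
  proof (rule LIMSEQ_I)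
    fix r :: real assume r: "0 < r"
    from LIMSEQ_D[OF assms(3), of "r/4"] r obtain i where i: "L2_sqnorm (\<lambda>x. f x - g i x) < r/4" by auto
    have gi: "g i \<in> L2" "fourier_residual (g i) \<longlonglongrightarrow> 0" using assms(2)[of i] by (auto simp: parseval_set_def)
    from LIMSEQ_D[OF gi(2), of "r/4"] r obtain M where M: "\<And>N. N \<ge> M \<Longrightarrow> fourier_residual (g i) N < r/4" by auto
    have "norm (fourier_residual f N - 0) < r" if "N \<ge> M" for N
    proof -
      have "fourier_residual f N \<le> 2 * fourier_residual (\<lambda>x. f x - g i x) N + 2 * fourier_residual (g i) N"
        using fourier_residual_add[OF L2_diff[OF assms(1) gi(1)] gi(1)] by simp
      moreover have "fourier_residual (\<lambda>x. f x - g i x) N < r / 4"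
        using fourier_residual_le[OF L2_diff[OF assms(1) gi(1)], of N] i by linarith
      ultimately show ?thesis using M[OF that] by simp
    qed
    thus "\<exists>M. \<forall>N\<ge>M. norm (fourier_residual f N - 0) < r" by blast
  qed
  thus ?thesis using assms(1) by (simp add: parseval_set_def)
qed

lemma parseval_set_dominated_limit:
  assumes f: "f \<in> borel_measurable leb01" and g: "\<And>i. g i \<in> parseval_set"
    and lim: "\<And>x. x \<in> {0..1} \<Longrightarrow> (\<lambda>i. g i x) \<longlonglongrightarrow> f x"
    and w: "integrable leb01 w" "\<And>i x. x \<in> {0..1} \<Longrightarrow> (cmod (g i x))\<^sup>2 \<le> w x"
      "\<And>x. x \<in> {0..1} \<Longrightarrow> (cmod (f x))\<^sup>2 \<le> w x"
  shows "f \<in> parseval_set"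
proof (rule parseval_set_limit[OF _ g])
  have gL: "g i \<in> L2" for i using g[of i] by (simp add: parseval_set_def)
  note [measurable] = f measurable_L2[OF gL]
  show "f \<in> L2" by (rule L2_dominated[OF f w(1,3)])
  have "(\<lambda>i. LINT x|leb01. (cmod (f x - g i x))\<^sup>2) \<longlonglongrightarrow> (LINT x|leb01. 0)"
  proof (rule integral_dominated_convergence)
    \<comment> \<open>By \<open>norm_add_sq_le\<close> the squared difference of two functions with
      squares below w is at most 2 w + 2 w.\<close>
    show "integrable leb01 (\<lambda>x. 4 * w x)" using w(1) by simp
    show "AE x in leb01. (\<lambda>i. (cmod (f x - g i x))\<^sup>2) \<longlonglongrightarrow> 0"
    proof (rule AE_I2)
      fix x assume "x \<in> space leb01"
      hence "(\<lambda>i. (cmod (f x - g i x))\<^sup>2) \<longlonglongrightarrow> (cmod (f x - f x))\<^sup>2"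
        using lim by (intro tendsto_intros) auto
      thus "(\<lambda>i. (cmod (f x - g i x))\<^sup>2) \<longlonglongrightarrow> 0" by simp
    qed
    show "AE x in leb01. norm ((cmod (f x - g i x))\<^sup>2) \<le> 4 * w x" for i
    proof (rule AE_I2)
      fix x assume "x \<in> space leb01"
      hence x: "x \<in> {0..1}" by simp
      show "norm ((cmod (f x - g i x))\<^sup>2) \<le> 4 * w x"
        using norm_add_sq_le[of "f x" "- g i x"] w(2)[OF x, of i] w(3)[OF x] by simp
    qed
  qed auto
  thus "(\<lambda>i. L2_sqnorm (\<lambda>x. f x - g i x)) \<longlonglongrightarrow> 0" by (simp add: L2_sqnorm_def)
qed

subsection \<open>Parseval's identity\<close>

text \<open>The half-lines \<open>{..<a}\<close> enter through \<open>sawtooth\<close> and generate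
  the Borel sets; passing to a closed interval costs only the null point \<open>a\<close>.\<close>

lemma LINT_leb01_indicator:
  fixes f :: "real \<Rightarrow> complex"
  assumes "a \<in> {0..1}" "integrable leb01 f"
  shows "(LINT x|leb01. indicator {..<a} x * f x) = (LINT x|lebesgue_on {0..a}. f x)"
proof -
  have "(LINT x|leb01. indicator {..<a} x * f x) = (LINT x|lebesgue. indicator {0..1} x *\<^sub>R (indicator {..<a} x * f x))"
    by (subst integral_restrict_space) auto
  also have "\<dots> = (LINT x|lebesgue. indicator {0..a} x *\<^sub>R f x)"
  proof (rule integral_cong_AE)
    have m: "(\<lambda>x. indicator {0..1} x *\<^sub>R f x) \<in> borel_measurable lebesgue"
      using assms(2) by (subst borel_measurable_restrict_space_iff[symmetric]) auto
    have "(\<lambda>x. indicator {0..<a} x *\<^sub>R (indicator {0..1} x *\<^sub>R f x)) \<in> borel_measurable lebesgue"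
      by (rule borel_measurable_scaleR[OF borel_measurable_indicator m]) (simp add: sets_completionI_sets)
    also have "(\<lambda>x. indicator {0..<a} x *\<^sub>R (indicator {0..1} x *\<^sub>R f x)) =
        (\<lambda>x. indicator {0..1} x *\<^sub>R (indicator {..<a} x * f x))"
      using assms(1) by (auto simp: fun_eq_iff indicator_def)
    finally show "(\<lambda>x. indicator {0..1} x *\<^sub>R (indicator {..<a} x * f x)) \<in> borel_measurable lebesgue" .
    have "(\<lambda>x. indicator {0..a} x *\<^sub>R (indicator {0..1} x *\<^sub>R f x)) \<in> borel_measurable lebesgue"
      by (rule borel_measurable_scaleR[OF borel_measurable_indicator m]) (simp add: sets_completionI_sets)
    also have "(\<lambda>x. indicator {0..a} x *\<^sub>R (indicator {0..1} x *\<^sub>R f x)) = (\<lambda>x. indicator {0..a} x *\<^sub>R f x)"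
      using assms(1) by (auto simp: fun_eq_iff indicator_def)
    finally show "(\<lambda>x. indicator {0..a} x *\<^sub>R f x) \<in> borel_measurable lebesgue" .
    have "AE x in lebesgue. x \<noteq> a"
      by (intro AE_completion AE_lborel_singleton)
    thus "AE x in lebesgue. indicator {0..1} x *\<^sub>R (indicator {..<a} x * f x) = indicator {0..a} x *\<^sub>R f x"
      by eventually_elim (use assms(1) in \<open>auto simp: indicator_def\<close>)
  qed
  also have "\<dots> = (LINT x|lebesgue_on {0..a}. f x)"
    by (subst integral_restrict_space) auto
  finally show ?thesis .
qed

text \<open>On the unit interval the function below is a translate of the 1-periodic extension of
  \<open>x - 1/2\<close>, so it satisfies Parseval's identity because \<open>1/1\<^sup>2 + 1/2\<^sup>2 + 1/3\<^sup>2 + \<dots> = pi\<^sup>2/6\<close>. Differences of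
  two translates are indicators of intervals up to a constant; a Dynkin argument and approximation
  by simple functions extend the identity to all of \<open>L2\<close>.\<close>

definition sawtooth :: "real \<Rightarrow> real \<Rightarrow> complex" where
  "sawtooth a x = of_real (x - a - 1/2) + indicator {..<a} x"

lemma indicator_L2: "A \<inter> {0..1} \<in> sets lebesgue \<Longrightarrow> (\<lambda>x. indicator A x) \<in> L2"
proof (rule L2_bounded[of _ 1])
  assume A: "A \<inter> {0..1} \<in> sets lebesgue"
  hence "A \<inter> {0..1} \<in> sets leb01" by (auto simp: sets_restrict_space)
  hence "(\<lambda>x. indicator (A \<inter> {0..1}) x :: complex) \<in> borel_measurable leb01" by simp
  also have "?this \<longleftrightarrow> (\<lambda>x. indicator A x :: complex) \<in> borel_measurable leb01"
    by (intro measurable_cong) (auto simp: indicator_def)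
  finally show "(\<lambda>x. indicator A x :: complex) \<in> borel_measurable leb01" .
qed (auto simp: indicator_def)

lemma L2_of_real_diff: "(\<lambda>x. complex_of_real (x - c)) \<in> L2"
  by (intro L2_continuous continuous_intros)

lemma L2_sawtooth: "sawtooth a \<in> L2"
  using L2_add[OF L2_of_real_diff[of "a + 1/2"] indicator_L2[of "{..<a}"]]
  by (simp add: sawtooth_def[abs_def] diff_diff_eq)

lemma fcoef_of_real_diff:
  assumes "n \<noteq> 0"
  shows "fcoef (\<lambda>x. complex_of_real (x - c)) n = \<i> / (2 * of_real pi * of_int n)"
proof -
  let ?k = "2 * of_real pi * \<i> * of_int (- n) :: complex"
  have k: "?k \<noteq> 0" using assms by simp
  \<comment> \<open>Antiderivative obtained by parts. Since \<open>fexp\<close> is 1 at both ends,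
    the second summand and \<open>c\<close> cancel in \<open>F 1 - F 0\<close>.\<close>
  define F where "F x = of_real (x - c) * (fexp (- n) x / ?k) - fexp (- n) x / ?k\<^sup>2" for x
  have "(F has_vector_derivative of_real (x - c) * fexp (- n) x) (at x within {0..1})" for x
  proof -
    have "(F has_vector_derivative
       (of_real (x - c) * ((?k * fexp (- n) x) / ?k) + 1 * (fexp (- n) x / ?k)) - ?k * fexp (- n) x / ?k\<^sup>2) (at x within {0..1})"
      unfolding F_def using k
      by (intro has_vector_derivative_diff has_vector_derivative_mult has_vector_derivative_divide
          fexp_has_vector_derivative has_vector_derivative_of_real) (auto intro!: derivative_eq_intros)
    also have "(of_real (x - c) * ((?k * fexp (- n) x) / ?k) + 1 * (fexp (- n) x / ?k)) - ?k * fexp (- n) x / ?k\<^sup>2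
        = of_real (x - c) * fexp (- n) x"
      using k by (simp add: power2_eq_square del: of_int_minus mult_minus_right)
    finally show ?thesis .
  qed
  from lebesgue_on_FTC[OF _ this]
  have "(LINT x|leb01. of_real (x - c) * fexp (- n) x) = F 1 - F 0"
    by (simp add: continuous_intros)
  also have "\<dots> = 1 / ?k" by (simp add: F_def diff_divide_distrib)
  also have "\<dots> = \<i> / (2 * of_real pi * of_int n)"
    using assms by (simp add: field_simps)
  finally show ?thesis by (simp add: fcoef_def L2_inner_def cnj_fexp)
qed

lemma fcoef_indicator:
  assumes "a \<in> {0..1}" "n \<noteq> 0"
  shows "fcoef (\<lambda>x. indicator {..<a} x) n = \<i> * (fexp (- n) a - 1) / (2 * of_real pi * of_int n)"
proof -
  have "fcoef (\<lambda>x. indicator {..<a} x) n = (LINT x|lebesgue_on {0..a}. fexp (- n) x)"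
    unfolding fcoef_def L2_inner_def cnj_fexp
    using assms(1) by (intro LINT_leb01_indicator integrable_L2) auto
  also have "\<dots> = (fexp (- n) a - 1) / (2 * of_real pi * \<i> * of_int (- n))"
    using assms by (subst integral_fexp) auto
  also have "\<dots> = \<i> * (fexp (- n) a - 1) / (2 * of_real pi * of_int n)"
    using assms(2) by (simp add: field_simps)
  finally show ?thesis .
qed

text \<open>Translating a periodic function multiplies its coefficients by numbers of modulus 1.
  Here the indicator contributes a multiple of \<open>fexp (- n) a - 1\<close> and the linear part
  supplies the missing 1.\<close>

lemma cmod_fcoef_sawtooth:
  assumes "a \<in> {0..1}" "n \<noteq> 0"
  shows "(cmod (fcoef (sawtooth a) n))\<^sup>2 = 1 / (4 * pi\<^sup>2 * (real_of_int n)\<^sup>2)"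
proof -
  have "fcoef (sawtooth a) n = fcoef (\<lambda>x. of_real (x - (a + 1/2))) n + fcoef (\<lambda>x. indicator {..<a} x) n"
    using fcoef_add[OF L2_of_real_diff[of "a + 1/2"] indicator_L2[of "{..<a}"]]
    by (simp add: sawtooth_def[abs_def] diff_diff_eq)
  also have "\<dots> = \<i> * fexp (- n) a / (2 * of_real pi * of_int n)"
    using assms(2) unfolding fcoef_of_real_diff[OF assms(2)] fcoef_indicator[OF assms] by (simp add: field_simps)
  finally show ?thesis by (simp add: norm_mult norm_divide power_mult_distrib power_divide)
qed

lemma LINT_leb01_polynomial:
  assumes "a \<in> {0..1}"
  shows "(LINT x|lebesgue_on {0..a}. complex_of_real (x - c)) = of_real (((a - c)\<^sup>2 - c\<^sup>2) / 2)"
    "(LINT x|lebesgue_on {0..a}. complex_of_real ((x - c)\<^sup>2)) = of_real (((a - c)^3 + c^3) / 3)"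
proof -
  have "((\<lambda>x. complex_of_real ((x - c)\<^sup>2 / 2)) has_vector_derivative of_real (x - c)) (at x within {0..a})" for x
    by (intro has_vector_derivative_of_real) (auto intro!: derivative_eq_intros)
  from lebesgue_on_FTC[OF _ this]
  show "(LINT x|lebesgue_on {0..a}. complex_of_real (x - c)) = of_real (((a - c)\<^sup>2 - c\<^sup>2) / 2)"
    using assms by (simp add: continuous_intros diff_divide_distrib)
  have "((\<lambda>x. complex_of_real ((x - c)^3 / 3)) has_vector_derivative of_real ((x - c)\<^sup>2)) (at x within {0..a})" for x
    by (intro has_vector_derivative_of_real) (auto intro!: derivative_eq_intros)
  from lebesgue_on_FTC[OF _ this]
  show "(LINT x|lebesgue_on {0..a}. complex_of_real ((x - c)^2)) = of_real (((a - c)^3 + c^3) / 3)"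
    using assms by (simp add: continuous_intros diff_divide_distrib add_divide_distrib)
qed

lemma L2_sqnorm_sawtooth:
  assumes a: "a \<in> {0..1}"
  shows "L2_sqnorm (sawtooth a) = 1 / 12"
proof -
  let ?c = "a + 1/2"
  \<comment> \<open>With t = x - a - 1/2, the square on the indicator is (t + 1)^2 = t^2 + 2 (t +
    1/2), and t + 1/2 = x - a. The value 1/12 is the integral of (x - 1/2)^2 over a period.\<close>
  have split: "sawtooth a x * cnj (sawtooth a x) =
      of_real ((x - ?c)\<^sup>2) + indicator {..<a} x * (2 * of_real (x - (a + 1/2 - 1/2)))" for x
    by (auto simp: sawtooth_def indicator_def power2_eq_square algebra_simps)
  have int: "integrable leb01 (\<lambda>x. 2 * complex_of_real (x - (a + 1/2 - 1/2)))"
    "integrable leb01 (\<lambda>x. complex_of_real ((x - ?c)\<^sup>2))"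
    by (intro continuous_imp_integrable_real continuous_intros)+
  have int2: "integrable leb01 (\<lambda>x. indicator {..<a} x * (2 * complex_of_real (x - (a + 1/2 - 1/2))))"
    using integrable_L2_mult[OF indicator_L2[of "{..<a}"] L2_cmult[OF L2_of_real_diff[of "a + 1/2 - 1/2"], of 2]]
    by simp
  have "complex_of_real (L2_sqnorm (sawtooth a)) = (LINT x|leb01. sawtooth a x * cnj (sawtooth a x))"
    by (simp add: L2_inner_self[symmetric] L2_inner_def)
  also have "\<dots> = (LINT x|leb01. of_real ((x - ?c)\<^sup>2)) +
      (LINT x|leb01. indicator {..<a} x * (2 * of_real (x - (a + 1/2 - 1/2))))"
    unfolding split by (rule Bochner_Integration.integral_add[OF int(2) int2])
  also have "(LINT x|leb01. indicator {..<a} x * (2 * complex_of_real (x - (a + 1/2 - 1/2)))) =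
      2 * of_real (((a - a)\<^sup>2 - a\<^sup>2) / 2)"
    unfolding LINT_leb01_indicator[OF a int(1)] Bochner_Integration.integral_mult_right_zero
    using LINT_leb01_polynomial(1)[OF a, of a] by simp
  also have "(LINT x|leb01. complex_of_real ((x - ?c)\<^sup>2)) = of_real (((1 - ?c)^3 + ?c^3) / 3)"
    by (rule LINT_leb01_polynomial) simp
  also have "of_real (((1 - ?c)^3 + ?c^3) / 3) + 2 * of_real (((a - a)\<^sup>2 - a\<^sup>2) / 2) =
      complex_of_real (((1 - ?c)^3 + ?c^3) / 3 + 2 * (((a - a)\<^sup>2 - a\<^sup>2) / 2))"
    by (simp only: of_real_add of_real_mult of_real_numeral)
  also have "((1 - ?c)^3 + ?c^3) / 3 + 2 * (((a - a)\<^sup>2 - a\<^sup>2) / 2) = 1 / 12"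
    by (simp add: power2_eq_square power3_eq_cube field_simps)
  finally show ?thesis unfolding of_real_eq_iff .
qed

text \<open>The frequencies k and -k together contribute 1 / (2 pi^2 k^2), which sums to 1/12, the
  full squared norm. Residuals are nonnegative, so a lower bound for the partial sums of squares
  suffices.\<close>

lemma parseval_set_sawtooth:
  assumes a: "a \<in> {0..1}"
  shows "sawtooth a \<in> parseval_set"
proof -
  let ?c = "\<lambda>n. (cmod (fcoef (sawtooth a) n))\<^sup>2"
  have sum_ge: "2 * (\<Sum>k<N. 1 / (4 * pi\<^sup>2 * (real k + 1)\<^sup>2)) \<le> (\<Sum>n\<in>{- int N..int N}. ?c n)" for N
  proof -
    let ?A = "(\<lambda>k. int k + 1) ` {..<N}" and ?B = "(\<lambda>k. - (int k + 1)) ` {..<N}"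
    have neg: "(real_of_int (- (int k + 1)))\<^sup>2 = (real k + 1)\<^sup>2" for k
      by (simp add: power2_eq_square algebra_simps)
    have "(\<Sum>n\<in>?A \<union> ?B. ?c n) = (\<Sum>n\<in>?A. ?c n) + (\<Sum>n\<in>?B. ?c n)"
      by (rule sum.union_disjoint) auto
    also have "(\<Sum>n\<in>?A. ?c n) = (\<Sum>k<N. 1 / (4 * pi\<^sup>2 * (real k + 1)\<^sup>2))"
      by (subst sum.reindex) (auto simp: inj_on_def cmod_fcoef_sawtooth[OF a] intro!: sum.cong)
    also have "(\<Sum>n\<in>?B. ?c n) = (\<Sum>k<N. ?c (- (int k + 1)))"
      by (subst sum.reindex) (auto simp: inj_on_def)
    also have "\<dots> = (\<Sum>k<N. 1 / (4 * pi\<^sup>2 * (real k + 1)\<^sup>2))"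
      unfolding neg[symmetric] by (intro sum.cong refl cmod_fcoef_sawtooth[OF a]) linarith
    finally have "2 * (\<Sum>k<N. 1 / (4 * pi\<^sup>2 * (real k + 1)\<^sup>2)) = (\<Sum>n\<in>?A \<union> ?B. ?c n)" by simp
    also have "\<dots> \<le> (\<Sum>n\<in>{- int N..int N}. ?c n)"
      by (intro sum_mono2) auto
    finally show ?thesis .
  qed
  have "(\<lambda>k. 1 / (4 * pi\<^sup>2) * (1 / (real k + 1)\<^sup>2)) sums (1 / (4 * pi\<^sup>2) * (pi\<^sup>2 / 6))"
    using inverse_squares_sums by (intro sums_mult) (simp add: add.commute)
  hence "(\<lambda>N. \<Sum>k<N. 1 / (4 * pi\<^sup>2 * (real k + 1)\<^sup>2)) \<longlonglongrightarrow> 1 / 24"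
    by (simp add: sums_def)
  hence "(\<lambda>N. 1 / 12 - 2 * (\<Sum>k<N. 1 / (4 * pi\<^sup>2 * (real k + 1)\<^sup>2))) \<longlonglongrightarrow> 1 / 12 - 2 * (1 / 24)"
    by (intro tendsto_intros)
  hence lim: "(\<lambda>N. 1 / 12 - 2 * (\<Sum>k<N. 1 / (4 * pi\<^sup>2 * (real k + 1)\<^sup>2))) \<longlonglongrightarrow> 0" by simp
  have "\<forall>\<^sub>F N in sequentially. norm (fourier_residual (sawtooth a) N) \<le>
      1 / 12 - 2 * (\<Sum>k<N. 1 / (4 * pi\<^sup>2 * (real k + 1)\<^sup>2))"
  proof (intro always_eventually allI)
    fix N
    show "norm (fourier_residual (sawtooth a) N) \<le> 1 / 12 - 2 * (\<Sum>k<N. 1 / (4 * pi\<^sup>2 * (real k + 1)\<^sup>2))"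
      using sum_ge[of N] fourier_residual_eq[OF L2_sawtooth, of a N] L2_sqnorm_sawtooth[OF a]
        fourier_residual_nonneg[of "sawtooth a" N] by simp
  qed
  from Lim_null_comparison[OF this lim] show ?thesis
    by (simp add: parseval_set_def L2_sawtooth)
qed

section \<open>From intervals to all square-integrable functions\<close>

lemma parseval_set_cong:
  assumes "f \<in> parseval_set" "g \<in> borel_measurable leb01" "AE x in leb01. f x = g x"
  shows "g \<in> parseval_set"
proof -
  have f: "f \<in> L2" using assms(1) by (simp add: parseval_set_def)
  have g: "g \<in> L2" by (rule L2_cong_AE[OF f assms(3,2)])
  have "fourier_residual g = fourier_residual f"
    using fcoef_cong_AE[OF assms(3) f g] L2_sqnorm_cong_AE[OF assms(3) measurable_L2[OF f] assms(2)]
    by (simp add: fun_eq_iff fourier_residual_eq f g)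
  thus ?thesis using assms(1) g by (simp add: parseval_set_def)
qed

lemma parseval_set_eqI:
  assumes "f \<in> parseval_set" "\<And>x. x \<in> {0..1} \<Longrightarrow> f x = g x"
  shows "g \<in> parseval_set"
proof (rule parseval_set_cong[OF assms(1)])
  have "f \<in> borel_measurable leb01" using assms(1) by (simp add: parseval_set_def measurable_L2)
  thus "g \<in> borel_measurable leb01"
    using assms(2) measurable_cong[of leb01 f g borel] by simp
  show "AE x in leb01. f x = g x" by (rule AE_I2) (use assms(2) in simp)
qed

lemma parseval_set_indicator_lessThan: "(\<lambda>x. indicator {..<a} x) \<in> parseval_set"
proof (cases "a \<in> {0..1}")
  case True
  have "(\<lambda>x. (sawtooth a x - sawtooth 0 x) + of_real a) \<in> parseval_set"
    using True by (intro parseval_set_add parseval_set_diff parseval_set_sawtooth parseval_set_const) auto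
  thus ?thesis by (rule parseval_set_eqI) (auto simp: sawtooth_def)
next
  case False
  show ?thesis
    by (rule parseval_set_eqI[OF parseval_set_const[of "if a < 0 then 0 else 1"]])
       (use False in \<open>auto simp: indicator_def\<close>)
qed

lemma parseval_set_indicator_borel:
  assumes "A \<in> sets borel"
  shows "(\<lambda>x. indicator A x) \<in> parseval_set"
proof -
  have A: "A \<in> sigma_sets UNIV (range (\<lambda>a::real. {..<a}))"
    using assms by (simp add: borel_Iio)
  have "Int_stable (range (\<lambda>a::real. {..<a}))"
  proof -
    have "{..<a} \<inter> {..<b} = {..<min a b}" for a b :: real by auto
    thus ?thesis by (auto simp: Int_stable_def)
  qed
  moreover have "range (\<lambda>a::real. {..<a}) \<subseteq> Pow UNIV" by simp
  ultimately show ?thesis using A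
  proof (induction A rule: sigma_sets_induct_disjoint)
    case (compl A)
    have "(\<lambda>x. 1 - indicator A x :: complex) \<in> parseval_set"
      by (intro parseval_set_diff parseval_set_const compl)
    thus ?case by (rule parseval_set_eqI) (auto simp: indicator_def)
  next
    case (union A)
    show ?case
    proof (rule parseval_set_dominated_limit)
      show "(\<lambda>x. \<Sum>i<n. indicator (A i) x :: complex) \<in> parseval_set" for n
        by (intro parseval_set_sum union)
      have sum_eq: "(\<Sum>i<n. indicator (A i) x :: complex) = indicator (\<Union>i<n. A i) x" for n x
        using union(1) by (intro indicator_UN_disjoint[symmetric]) (auto simp: disjoint_family_on_def)
      show "(\<lambda>n. \<Sum>i<n. indicator (A i) x) \<longlonglongrightarrow> (indicator (\<Union> (range A)) x :: complex)" for x
        unfolding sum_eq using LIMSEQ_indicator_UN[of A x] by simp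
      show "(cmod (\<Sum>i<n. indicator (A i) x))\<^sup>2 \<le> 1" for n x
        unfolding sum_eq by (auto simp: indicator_def)
      show "integrable leb01 (\<lambda>x. 1 :: real)"
        using finite_measure.integrable_const[OF finite_measure_leb01] by blast
      have "A i \<in> sets borel" for i using union(2) by (auto simp: borel_Iio)
      hence "\<Union> (range A) \<in> sets lebesgue" by auto
      thus "(indicator (\<Union> (range A)) :: real \<Rightarrow> complex) \<in> borel_measurable leb01"
        by (intro measurable_L2 indicator_L2 sets.Int) auto
    qed (auto simp: indicator_def)
  qed (auto simp: parseval_set_indicator_lessThan parseval_set_const)
qed

lemma AE_leb01_iff: "(AE x in leb01. P x) \<longleftrightarrow> (AE x in lebesgue. x \<in> {0..1} \<longrightarrow> P x)"
  by (rule AE_restrict_space_iff) simp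

text \<open>A Lebesgue set is a Borel set up to a null set, which coefficients and norms
  ignore.\<close>

lemma parseval_set_indicator:
  assumes "A \<in> sets lebesgue"
  shows "(\<lambda>x. indicator A x) \<in> parseval_set"
proof -
  obtain S N N' where A: "A = S \<union> N" "N \<subseteq> N'" "N' \<in> null_sets lborel" "S \<in> sets lborel"
    using sets_completionE[OF assms] by blast
  show ?thesis
  proof (rule parseval_set_cong[OF parseval_set_indicator_borel])
    show "S \<in> sets borel" using A by simp
    show "(\<lambda>x. indicator A x :: complex) \<in> borel_measurable leb01"
      using assms by (intro measurable_L2 indicator_L2) auto
    have "AE x in lebesgue. x \<notin> N'" using A(3) by (intro AE_completion AE_not_in)
    hence "AE x in lebesgue. indicator S x = (indicator A x :: complex)"
      by eventually_elim (use A(1,2) in \<open>auto simp: indicator_def\<close>)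
    thus "AE x in leb01. indicator S x = (indicator A x :: complex)"
      unfolding AE_leb01_iff by eventually_elim simp
  qed
qed

theorem parseval_set_eq_L2: "parseval_set = L2"
proof
  show "L2 \<subseteq> parseval_set"
  proof
    fix f :: "real \<Rightarrow> complex" assume f: "f \<in> L2"
    obtain s where s: "\<And>i. simple_function leb01 (s i)"
      "\<And>x. x \<in> space leb01 \<Longrightarrow> (\<lambda>i. s i x) \<longlonglongrightarrow> f x"
      "\<And>i x. x \<in> space leb01 \<Longrightarrow> dist (s i x) 0 \<le> 2 * dist (f x) 0"
      using borel_measurable_implies_sequence_metric[OF measurable_L2[OF f], of 0] by metis
    show "f \<in> parseval_set"
    proof (rule parseval_set_dominated_limit[where g = s])
      show "s i \<in> parseval_set" for i
      proof -
        have sets: "s i -` {y} \<inter> space leb01 \<in> sets lebesgue" for y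
          using simple_functionD(2)[OF s(1), of i "{y}"] by (simp add: sets_restrict_space_iff)
        have "(\<lambda>x. \<Sum>y\<in>s i ` space leb01. y * indicator (s i -` {y} \<inter> space leb01) x) \<in> parseval_set"
          by (intro parseval_set_sum parseval_set_cmult parseval_set_indicator sets)
        thus ?thesis
        proof (rule parseval_set_eqI)
          fix x :: real assume "x \<in> {0..1}"
          have "complex_of_real (of_bool P) = of_bool P" for P by simp
          with \<open>x \<in> {0..1}\<close> show "(\<Sum>y\<in>s i ` space leb01. y * indicator (s i -` {y} \<inter> space leb01) x) = s i x"
            using simple_function_indicator_representation_banach[OF s(1), of x i]
            by (simp add: scaleR_conv_of_real indicator_def mult.commute)
        qed
      qed
      show "integrable leb01 (\<lambda>x. 4 * (cmod (f x))\<^sup>2)" using integrable_sq_L2[OF f] by simp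
      show "(cmod (s i x))\<^sup>2 \<le> 4 * (cmod (f x))\<^sup>2" if "x \<in> {0..1}" for i x
        using power_mono[OF s(3)[of x i], of 2] that by (simp add: power_mult_distrib)
    qed (use s f in \<open>auto simp: measurable_L2\<close>)
  qed
qed (auto simp: parseval_set_def)

theorem parseval:
  assumes f: "f \<in> L2"
  shows "((\<lambda>n. (cmod (fcoef f n))\<^sup>2) has_sum L2_sqnorm f) UNIV"
proof -
  let ?c = "\<lambda>n. (cmod (fcoef f n))\<^sup>2"
  have "?c summable_on UNIV"
    by (rule nonneg_bdd_above_summable_on) (auto intro!: bdd_aboveI2 bessel_ineq[OF f])
  then obtain S where S: "(?c has_sum S) UNIV" by (auto simp: summable_on_def)
  \<comment> \<open>\<open>has_sum\<close> runs over all finite index sets; the symmetric intervals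
    are cofinal among them, so the symmetric partial sums have the same limit.\<close>
  have "filterlim (\<lambda>N. {- int N..int N}) (finite_subsets_at_top UNIV) sequentially"
    unfolding filterlim_finite_subsets_at_top
  proof (intro allI impI)
    fix X :: "int set" assume X: "finite X \<and> X \<subseteq> UNIV"
    have le: "\<bar>n\<bar> \<le> (\<Sum>n\<in>X. \<bar>n\<bar>)" if "n \<in> X" for n
      using X that by (intro member_le_sum) auto
    show "\<forall>\<^sub>F N in sequentially. finite {- int N..int N} \<and> X \<subseteq> {- int N..int N} \<and> {- int N..int N} \<subseteq> UNIV"
      using eventually_ge_at_top[of "nat (\<Sum>n\<in>X. \<bar>n\<bar>)"]
    proof eventually_elim
      case (elim N)
      have "n \<in> {- int N..int N}" if "n \<in> X" for n
        using le[OF that] elim by auto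
      thus ?case by auto
    qed
  qed
  with S have "(\<lambda>N. \<Sum>n\<in>{- int N..int N}. ?c n) \<longlonglongrightarrow> S"
    unfolding has_sum_def by (rule filterlim_compose)
  hence "(\<lambda>N. L2_sqnorm f - (\<Sum>n\<in>{- int N..int N}. ?c n)) \<longlonglongrightarrow> L2_sqnorm f - S"
    by (intro tendsto_intros)
  moreover have "fourier_residual f \<longlonglongrightarrow> 0"
    using f parseval_set_eq_L2 by (auto simp: parseval_set_def)
  hence "(\<lambda>N. L2_sqnorm f - (\<Sum>n\<in>{- int N..int N}. ?c n)) \<longlonglongrightarrow> 0"
    by (simp add: fourier_residual_eq[OF f, abs_def])
  ultimately have "L2_sqnorm f - S = 0" using LIMSEQ_unique by blast
  thus ?thesis using S by simp
qed

text \<open>Completeness of the exponentials: the difference has zero coefficients, hence zero norm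
  by Parseval. Eigenvectors are identified through it.\<close>

theorem fcoef_unique:
  assumes "f \<in> L2" "g \<in> L2" "\<And>n. fcoef f n = fcoef g n"
  shows "AE x in leb01. f x = g x"
proof -
  have L2: "(\<lambda>x. f x - g x) \<in> L2" using assms by (intro L2_diff)
  from parseval[OF L2] have "((\<lambda>n::int. 0) has_sum L2_sqnorm (\<lambda>x. f x - g x)) UNIV"
    using assms by (simp add: fcoef_diff)
  moreover have "((\<lambda>n::int. 0) has_sum (0::real)) UNIV" by (rule has_sum_0) simp
  ultimately have "L2_sqnorm (\<lambda>x. f x - g x) = 0" by (rule has_sum_unique)
  thus ?thesis using L2_sqnorm_eq_0_iff[OF L2] by simp
qed

subsection \<open>Antiderivatives and the unperturbed operator\<close>

lemma LINT_leb01_indicator_Icc: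
  fixes f :: "real \<Rightarrow> complex"
  assumes "0 \<le> a" "b \<le> 1"
  shows "(LINT x|leb01. indicator {a..b} x * f x) = (LINT x|lebesgue_on {a..b}. f x)"
proof -
  have "(LINT x|leb01. indicator {a..b} x * f x) = (LINT x|lebesgue. indicator {0..1} x *\<^sub>R (indicator {a..b} x * f x))"
    by (subst integral_restrict_space) auto
  also have "(\<lambda>x. indicator {0..1} x *\<^sub>R (indicator {a..b} x * f x)) = (\<lambda>x. indicator {a..b} x *\<^sub>R f x)"
    using assms by (auto simp: fun_eq_iff indicator_def)
  also have "(LINT x|lebesgue. indicator {a..b} x *\<^sub>R f x) = (LINT x|lebesgue_on {a..b}. f x)"
    by (subst integral_restrict_space) auto
  finally show ?thesis .
qed

text \<open>The Lebesgue integral is replaced by the gauge integral, whose indefinite integral is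
  continuous.\<close>

lemma sobolev_deriv_continuous:
  assumes "sobolev_deriv Y g"
  shows "continuous_on {0..1} Y"
proof -
  have g: "integrable leb01 g" using assms by (auto simp: sobolev_deriv_def integrable_L2)
  have int: "integrable (lebesgue_on {0..x}) g" if "x \<in> {0..1}" for x
  proof -
    have "integrable lebesgue (\<lambda>t. indicator {0..x} t *\<^sub>R (indicator {0..1} t *\<^sub>R g t))"
      by (rule integrable_mult_indicator) (use g in \<open>simp_all add: integrable_restrict_space\<close>)
    also have "(\<lambda>t. indicator {0..x} t *\<^sub>R (indicator {0..1} t *\<^sub>R g t)) = (\<lambda>t. indicator {0..x} t *\<^sub>R g t)"
      using that by (auto simp: fun_eq_iff indicator_def)
    finally show ?thesis by (simp add: integrable_restrict_space)
  qed
  have eq: "Y x = Y 0 + integral {0..x} g" if "x \<in> {0..1}" for x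
  proof -
    have *: "(LINT t|lebesgue_on {0..x}. g t) = integral {0..x} g"
      by (rule lebesgue_integral_eq_integral) (use int[OF that] in auto)
    have "Y x = Y 0 + (LINT t|lebesgue_on {0..x}. g t)"
      using assms that unfolding sobolev_deriv_def by blast
    thus ?thesis unfolding * .
  qed
  have "g integrable_on {0..1}" using g by (intro integrable_on_lebesgue_on) auto
  hence "continuous_on {0..1} (\<lambda>x. Y 0 + integral {0..x} g)"
    by (intro continuous_intros indefinite_integral_continuous_1)
  thus ?thesis by (rule continuous_on_eq) (simp add: eq[symmetric])
qed

lemma sobolev_deriv_L2: "sobolev_deriv Y g \<Longrightarrow> Y \<in> L2"
  by (intro L2_continuous sobolev_deriv_continuous)

lemma LINT_leb01_tail_fexp:
  assumes "n \<noteq> 0" "t \<in> {0..1}"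
  shows "(LINT x|leb01. (if t \<le> x then 1 else 0) * fexp n x) = (1 - fexp n t) / (2 * of_real pi * \<i> * of_int n)"
proof -
  have "(LINT x|leb01. (if t \<le> x then 1 else 0) * fexp n x) = (LINT x|leb01. indicator {t..1} x * fexp n x)"
    by (intro Bochner_Integration.integral_cong) (auto simp: indicator_def)
  also have "\<dots> = (LINT x|lebesgue_on {t..1}. fexp n x)"
    using assms by (intro LINT_leb01_indicator_Icc) auto
  finally show ?thesis using integral_fexp[OF assms(1), of t 1] assms(2) by simp
qed

text \<open>Integration by parts, by exchanging the integrals over \<open>t \<le> x\<close> in \<open>Y x = Y 0 + \<integral>g t dt\<close>.\<close>

lemma fcoef_sobolev_deriv:
  assumes Y: "sobolev_deriv Y g"
  shows "fcoef g n = 2 * of_real pi * \<i> * of_int n * fcoef Y n + (Y 1 - Y 0)"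
proof -
  have g: "g \<in> L2" using Y by (simp add: sobolev_deriv_def)
  have g0: "fcoef g 0 = Y 1 - Y 0"
  proof -
    have "\<forall>x\<in>{0..1}. Y x = Y 0 + (LINT t|lebesgue_on {0..x}. g t)"
      using Y unfolding sobolev_deriv_def by blast
    from bspec[OF this, of 1] have "Y 1 - Y 0 = (LINT t|leb01. g t)" by (simp only: atLeastAtMost_iff) simp
    thus ?thesis by (simp add: fcoef_def L2_inner_def)
  qed
  show ?thesis
  proof (cases "n = 0")
    case False
    let ?k = "2 * of_real pi * \<i> * of_int (- n) :: complex"
    define F where "F t x = (if t \<le> x then 1 else 0) * (g t * fexp (- n) x)" for t x :: real
    note [measurable] = measurable_L2[OF g] measurable_L2[OF L2_fexp]
    have [measurable]: "(\<lambda>x. x) \<in> borel_measurable leb01"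
      using id_borel_measurable_lebesgue_on[of "{0..1}"] by (simp add: id_def)
    interpret finite_measure leb01 by (rule finite_measure_leb01)
    interpret pair_sigma_finite leb01 leb01 ..
    have F_meas: "case_prod F \<in> borel_measurable (leb01 \<Otimes>\<^sub>M leb01)"
      unfolding F_def case_prod_unfold by measurable
    have F_x: "(LINT x|leb01. F t x) = g t * ((1 - fexp (- n) t) / ?k)" if "t \<in> {0..1}" for t
      using LINT_leb01_tail_fexp[of "- n" t] False that unfolding F_def
      by (simp add: mult.left_commute[of _ "g t"])
    have F_le: "norm (F t x) \<le> cmod (g t)" for t x by (auto simp: F_def norm_mult)
    have F_int_x: "integrable leb01 (\<lambda>x. F t x)" if "t \<in> space leb01" for t
    proof (rule Bochner_Integration.integrable_bound[OF integrable_const[of "cmod (g t)"]])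
      show "(\<lambda>x. F t x) \<in> borel_measurable leb01" unfolding F_def by measurable
    qed (use F_le in auto)
    have F_int: "integrable (leb01 \<Otimes>\<^sub>M leb01) (case_prod F)"
    proof (rule Fubini_integrable[OF F_meas])
      show "AE t in leb01. integrable leb01 (\<lambda>x. case_prod F (t, x))"
        using F_int_x by (intro AE_I2) simp
      show "integrable leb01 (\<lambda>t. LINT x|leb01. norm (case_prod F (t, x)))"
      proof (rule Bochner_Integration.integrable_bound[OF integrable_norm[OF integrable_L2[OF g]]])
        show "(\<lambda>t. LINT x|leb01. norm (case_prod F (t, x))) \<in> borel_measurable leb01"
          using F_meas by measurable
        show "AE t in leb01. norm (LINT x|leb01. norm (case_prod F (t, x))) \<le> norm (norm (g t))"
        proof (rule AE_I2)
          fix t assume t: "t \<in> space leb01"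
          have "(LINT x|leb01. norm (F t x)) \<le> (LINT x|leb01. cmod (g t))"
            by (intro integral_mono integrable_norm F_int_x t F_le integrable_const)
          also have "\<dots> = cmod (g t)" by (simp add: measure_restrict_space)
          finally show "norm (LINT x|leb01. norm (case_prod F (t, x))) \<le> norm (norm (g t))" by simp
        qed
      qed
    qed
    have F_t: "(LINT t|leb01. F t x) = (Y x - Y 0) * fexp (- n) x" if "x \<in> {0..1}" for x
    proof -
      have "(LINT t|leb01. F t x) = (LINT t|leb01. indicator {0..x} t * (g t * fexp (- n) x))"
        by (intro Bochner_Integration.integral_cong) (auto simp: F_def indicator_def)
      also have "\<dots> = (LINT t|lebesgue_on {0..x}. g t) * fexp (- n) x"
        using that by (subst LINT_leb01_indicator_Icc) auto
      also have "(LINT t|lebesgue_on {0..x}. g t) = Y x - Y 0"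
      proof -
        have "Y x = Y 0 + (LINT t|lebesgue_on {0..x}. g t)" using Y that unfolding sobolev_deriv_def by blast
        thus ?thesis by simp
      qed
      finally show ?thesis .
    qed
    have "fcoef (\<lambda>x. Y x - Y 0) n = (LINT x|leb01. (LINT t|leb01. F t x))"
      unfolding fcoef_def L2_inner_def cnj_fexp
      by (intro Bochner_Integration.integral_cong) (simp_all add: F_t)
    also have "\<dots> = (LINT t|leb01. (LINT x|leb01. F t x))"
      by (rule Fubini_integral[OF F_int])
    \<comment> \<open>The constant 1 is written as \<open>cnj (fexp 0 t)\<close>, so that both parts
      become Fourier coefficients of \<open>g\<close>.\<close>
    also have "\<dots> = (LINT t|leb01. (1 / ?k) * (g t * cnj (fexp 0 t) - g t * cnj (fexp n t)))"
      by (intro Bochner_Integration.integral_cong)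
         (simp_all add: F_x cnj_fexp right_diff_distrib diff_divide_distrib)
    also have "\<dots> = (1 / ?k) * (fcoef g 0 - fcoef g n)"
      unfolding fcoef_def L2_inner_def integral_mult_right_zero
      by (subst Bochner_Integration.integral_diff) (use g integrable_L2_mult L2_fexp in blast)+
    finally have "fcoef (\<lambda>x. Y x - Y 0) n = (fcoef g 0 - fcoef g n) / ?k" by simp
    moreover have "fcoef (\<lambda>x. Y x - Y 0) n = fcoef Y n"
      using fcoef_diff[OF sobolev_deriv_L2[OF Y] L2_continuous[of "\<lambda>x. Y 0"], of n]
        fcoef_cmult[of "Y 0" "fexp 0" n] False by (simp add: fcoef_fexp)
    ultimately show ?thesis using False g0 by (simp add: field_simps)
  qed (use g0 in simp)
qed

text \<open>The vanishing mean of \<open>g\<close> makes the antiderivative periodic, and the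
  constant of integration is spent on prescribing the mean \<open>c\<close>. Extension by 0 follows
  the convention for operator domains.\<close>

lemma sobolev_antiderivative:
  assumes g: "g \<in> L2" "fcoef g 0 = 0"
  obtains Y where "sobolev_deriv Y g" "Y 1 = Y 0" "fcoef Y 0 = c" "\<And>x. x \<notin> {0..1} \<Longrightarrow> Y x = 0"
proof -
  define G where "G K x = (if x \<in> {0..1} then K + (LINT t|lebesgue_on {0..x}. g t) else 0)" for K x
  have "(LINT t|lebesgue_on {0..0}. g t) = (LINT t|lebesgue. indicator {0..0} t *\<^sub>R g t)"
    by (subst integral_restrict_space) auto
  also have "\<dots> = 0"
  proof (rule integral_eq_zero_AE)
    have "AE t in lebesgue. t \<noteq> (0::real)" by (intro AE_completion AE_lborel_singleton)
    thus "AE t in lebesgue. indicator {0..0} t *\<^sub>R g t = 0" by eventually_elim simp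
  qed
  finally have G0: "G K 0 = K" for K unfolding G_def by simp
  have sob: "sobolev_deriv (G K) g" for K
    using g(1) G0[of K] by (simp add: sobolev_deriv_def) (simp add: G_def)
  have G1: "G K 1 = G K 0" for K
    using g(2) G0[of K] by (simp add: G_def fcoef_def L2_inner_def)
  have "fcoef (G K) 0 = K + fcoef (G 0) 0" for K
  proof -
    have "fcoef (G K) 0 = fcoef (\<lambda>x. K * fexp 0 x + G 0 x) 0"
      unfolding fcoef_def L2_inner_def
      by (intro Bochner_Integration.integral_cong) (auto simp: G_def)
    also have "\<dots> = K + fcoef (G 0) 0"
      using fcoef_add[OF L2_cmult[OF L2_fexp[of 0]] sobolev_deriv_L2[OF sob[of 0]]] fcoef_cmult[of K "fexp 0" 0]
      by (simp add: fcoef_fexp)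
    finally show ?thesis .
  qed
  from this[of "c - fcoef (G 0) 0"] have "fcoef (G (c - fcoef (G 0) 0)) 0 = c"
    unfolding diff_add_cancel .
  moreover have "G K x = 0" if "x \<notin> {0..1}" for K x unfolding G_def using that by (rule if_not_P)
  ultimately show ?thesis by (rule that[OF sob G1])
qed

section \<open>The unperturbed operator on Fourier coefficients\<close>

definition cube_freq :: "int \<Rightarrow> real" where
  "cube_freq n = (2 * pi * of_int n)^3"

text \<open>Three integrations by parts, with boundary terms killed by the periodic boundary
  conditions.\<close>

lemma L_zero_fcoef:
  assumes "L_zero y f"
  shows "fcoef f n = of_real (cube_freq n) * fcoef y n"
proof -
  obtain y1 y2 y3 where y: "sobolev_deriv y y1" "sobolev_deriv y1 y2" "sobolev_deriv y2 y3"
    "y 1 = y 0" "y1 1 = y1 0" "y2 1 = y2 0" and f: "f \<in> L2" "AE x in leb01. f x = \<i> * y3 x"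
    using assms unfolding L_zero_def by blast
  have "y3 \<in> L2" using y(3) by (simp add: sobolev_deriv_def)
  hence "fcoef f n = \<i> * fcoef y3 n"
    using fcoef_cong_AE[OF f(2,1) L2_cmult] by (simp add: fcoef_cmult)
  also have "fcoef y3 n = (2 * of_real pi * \<i> * of_int n)^3 * fcoef y n"
    using fcoef_sobolev_deriv[OF y(1), of n] fcoef_sobolev_deriv[OF y(2), of n]
      fcoef_sobolev_deriv[OF y(3), of n] y(4-6) by (simp add: power3_eq_cube)
  also have "\<i> * ((2 * of_real pi * \<i> * of_int n)^3 * fcoef y n) = of_real (cube_freq n) * fcoef y n"
  proof -
    have "\<i> * (2 * of_real pi * \<i> * of_int n)^3 = (\<i> * \<i>) * (\<i> * \<i>) * (2 * complex_of_real pi * of_int n)^3"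
      by (simp only: power3_eq_cube mult_ac)
    thus ?thesis by (simp add: cube_freq_def mult.assoc[symmetric])
  qed
  finally show ?thesis .
qed

lemma L_zero_dom:
  assumes "L_zero y f"
  shows "y \<in> L2" "f \<in> L2" "continuous_on {0..1} y" "\<And>x. x \<notin> {0..1} \<Longrightarrow> y x = 0"
  using assms sobolev_deriv_L2 sobolev_deriv_continuous unfolding L_zero_def by blast+

text \<open>The function \<open>- \<i> * f\<close> is integrated three times. The intermediate
  antiderivatives get mean 0, so that the next one is again periodic; the last mean is free because
  the constants form the kernel of \<open>L_zero\<close>.\<close>

lemma L_zero_inverse:
  assumes f: "f \<in> L2" "fcoef f 0 = 0"
  obtains y where "L_zero y f" "fcoef y 0 = c"
proof -
  have "(\<lambda>x. - \<i> * f x) \<in> L2" "fcoef (\<lambda>x. - \<i> * f x) 0 = 0"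
    using L2_cmult[OF f(1), of "- \<i>"] fcoef_cmult[of "- \<i>" f 0] f(2) by simp_all
  then obtain y2 where y2: "sobolev_deriv y2 (\<lambda>x. - \<i> * f x)" "y2 1 = y2 0" "fcoef y2 0 = 0"
    using sobolev_antiderivative by metis
  then obtain y1 where y1: "sobolev_deriv y1 y2" "y1 1 = y1 0" "fcoef y1 0 = 0"
    using sobolev_antiderivative[OF sobolev_deriv_L2[OF y2(1)]] by metis
  then obtain y where y: "sobolev_deriv y y1" "y 1 = y 0" "fcoef y 0 = c" "\<And>x. x \<notin> {0..1} \<Longrightarrow> y x = 0"
    using sobolev_antiderivative[OF sobolev_deriv_L2[OF y1(1)]] by metis
  have "L_zero y f"
    unfolding L_zero_def using y y1 y2 f(1)
    by (intro conjI allI impI exI[of _ y1] exI[of _ y2] exI[of _ "\<lambda>x. - \<i> * f x"]) (auto simp: mult.assoc[symmetric])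
  thus ?thesis using that y(3) by blast
qed

lemma continuous_AE_eq_0:
  assumes "continuous_on {0..1} y" "\<And>x. x \<notin> {0..1} \<Longrightarrow> y x = (0::complex)" "AE x in leb01. y x = 0"
  shows "y = (\<lambda>x. 0)"
proof -
  have cl: "closed ({0..1} \<inter> y -` {0})"
    using assms(1) by (intro continuous_closed_preimage) auto
  \<comment> \<open>A closed set of full measure on the line is the whole line, so the outside of
    the interval is adjoined. This swallows the endpoints, which are recovered afterwards as limits
    of interior points.\<close>
  hence cl': "closed (({0..1} \<inter> y -` {0}) \<union> {..0} \<union> {1..})" by (intro closed_Un) auto
  have "AE x in lebesgue. x \<in> ({0..1} \<inter> y -` {0}) \<union> {..0} \<union> {1..}"
    using assms(3) unfolding AE_leb01_iff by eventually_elim auto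
  hence *: "x \<in> ({0..1} \<inter> y -` {0}) \<union> {..0} \<union> {1..}" for x
    using mem_closed_if_AE_lebesgue[OF cl'] by blast
  have in01: "y x = 0" if "x \<in> {0<..<1}" for x using *[of x] that by auto
  have "y x = 0" if "x \<in> {0..1}" for x
  proof -
    have "closure {0<..<1::real} \<subseteq> {0..1} \<inter> y -` {0}"
      by (rule closure_minimal[OF _ cl]) (use in01 in auto)
    thus ?thesis using that by auto
  qed
  thus ?thesis using assms(2) by (auto simp: fun_eq_iff)
qed

text \<open>Absolutely summable coefficients give uniform convergence, which passes to inner
  products because \<open>h\<close> is integrable. The vector \<open>u\<close> of
  \<open>resolvent_vector\<close> is built this way.\<close>

lemma fourier_series_has_sum:
  assumes c: "(\<lambda>n. norm (c n)) summable_on UNIV"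
  obtains u where "u \<in> L2" "\<And>h. h \<in> L2 \<Longrightarrow> ((\<lambda>n. c n * L2_inner (fexp n) h) has_sum L2_inner u h) UNIV"
    "\<And>n. fcoef u n = c n"
proof -
  define u where "u x = (\<Sum>\<^sub>\<infinity>n. c n * fexp n x)" for x
  have ul: "uniform_limit {0..1} (\<lambda>X x. \<Sum>n\<in>X. c n * fexp n x) u (finite_subsets_at_top UNIV)"
    unfolding u_def by (rule Weierstrass_m_test_general[OF _ c]) (simp add: norm_mult)
  have "continuous_on {0..1} u"
    by (rule uniform_limit_theorem[OF _ ul]) (auto intro!: always_eventually continuous_intros)
  hence u: "u \<in> L2" by (rule L2_continuous)
  have inner: "((\<lambda>n. c n * L2_inner (fexp n) h) has_sum L2_inner u h) UNIV" if h: "h \<in> L2" for h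
    unfolding has_sum_def
  proof (rule tendstoI)
    fix e :: real assume e: "e > 0"
    define H where "H = (LINT x|leb01. cmod (h x))"
    have H: "H \<ge> 0" by (simp add: H_def)
    have hi: "integrable leb01 (\<lambda>x. cmod (h x))" using integrable_L2[OF h] by (rule integrable_norm)
    \<comment> \<open>The summand 1 keeps \<open>d\<close> positive when \<open>H = 0\<close> and
      the final inequality strict.\<close>
    define d where "d = e / (H + 1)"
    have d: "d > 0" using e H by (simp add: d_def)
    show "\<forall>\<^sub>F X in finite_subsets_at_top UNIV. dist (\<Sum>n\<in>X. c n * L2_inner (fexp n) h) (L2_inner u h) < e"
      using uniform_limitD[OF ul d]
    proof eventually_elim
      case (elim X)
      let ?S = "\<lambda>x. \<Sum>n\<in>X. c n * fexp n x"
      have S: "?S \<in> L2" by (intro L2_sum L2_cmult L2_fexp)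
      have "(\<Sum>n\<in>X. c n * L2_inner (fexp n) h) = L2_inner ?S h"
        using h by (simp add: L2_inner_sum_left L2_inner_cmult_left L2_cmult)
      hence "dist (\<Sum>n\<in>X. c n * L2_inner (fexp n) h) (L2_inner u h) = cmod (L2_inner (\<lambda>x. ?S x - u x) h)"
        using L2_inner_diff_left[OF S u h] by (simp add: dist_norm)
      also have "\<dots> \<le> (LINT x|leb01. cmod ((?S x - u x) * cnj (h x)))"
        unfolding L2_inner_def by (rule integral_norm_bound)
      also have "\<dots> \<le> (LINT x|leb01. d * cmod (h x))"
      proof (rule integral_mono)
        show "integrable leb01 (\<lambda>x. cmod ((?S x - u x) * cnj (h x)))"
          using integrable_norm[OF integrable_L2_mult[OF L2_diff[OF S u] h]] .
        show "cmod ((?S x - u x) * cnj (h x)) \<le> d * cmod (h x)" if "x \<in> space leb01" for x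
        proof -
          have "cmod (?S x - u x) \<le> d" using elim that by (auto simp: dist_norm less_imp_le)
          thus ?thesis by (simp add: norm_mult mult_right_mono)
        qed
      qed (use hi in simp)
      also have "\<dots> = d * H" by (simp add: H_def)
      also have "\<dots> < e" using e H by (simp add: d_def field_simps)
      finally show ?case .
    qed
  qed
  have "fcoef u n = c n" for n
  proof -
    have "((\<lambda>m. if m = n then c n else 0) has_sum fcoef u n) UNIV"
      using inner[OF L2_fexp, of n] unfolding fcoef_def L2_inner_fexp
      by (rule has_sum_cong[THEN iffD1, rotated]) auto
    moreover have "((\<lambda>m. if m = n then c n else 0) has_sum c n) UNIV"
      by (rule has_sum_finite_neutralI[of "{n}"]) auto
    ultimately show ?thesis by (rule has_sum_unique)
  qed
  thus ?thesis using that u inner by blast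
qed

subsection \<open>Eigenspaces\<close>

lemma cube_freq_0 [simp]: "cube_freq 0 = 0"
  by (simp add: cube_freq_def)

text \<open>Cubes of distinct integers are distinct integers, hence at least 1 apart, and the factor
  (2 pi)^3 only enlarges the gaps.\<close>

interpretation cubes: separated_reals cube_freq
proof
  fix m n :: int assume "m \<noteq> n"
  have "m^3 \<noteq> n^3"
  proof
    assume "m^3 = n^3"
    hence "root 3 (real_of_int m ^ 3) = root 3 (real_of_int n ^ 3)" by (simp flip: of_int_power)
    thus False using \<open>m \<noteq> n\<close> by (simp add: odd_real_root_power_cancel)
  qed
  hence "1 \<le> \<bar>m^3 - n^3\<bar>" by linarith
  hence 1: "1 \<le> \<bar>real_of_int (m^3 - n^3)\<bar>" by linarith
  have "1 \<le> 2 * pi" using pi_gt3 by linarith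
  hence 2: "1 \<le> (2 * pi)^3" by (rule one_le_power)
  have "cube_freq m - cube_freq n = (2 * pi)^3 * real_of_int (m^3 - n^3)"
    by (simp add: cube_freq_def power_mult_distrib algebra_simps)
  hence "\<bar>cube_freq m - cube_freq n\<bar> = (2 * pi)^3 * \<bar>real_of_int (m^3 - n^3)\<bar>"
    by (simp add: abs_mult)
  thus "1 \<le> \<bar>cube_freq m - cube_freq n\<bar>"
    using mult_mono[OF 2 1] by simp
qed

lemma continuous_AE_eqI:
  assumes "continuous_on {0..1} y" "\<And>x. x \<notin> {0..1} \<Longrightarrow> y x = (0::complex)"
    "continuous_on {0..1} z" "\<And>x. x \<notin> {0..1} \<Longrightarrow> z x = (0::complex)" "AE x in leb01. y x = z x"
  shows "y = z"
proof -
  have "(\<lambda>x. y x - z x) = (\<lambda>x. 0)"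
    using assms by (intro continuous_AE_eq_0 continuous_intros) auto
  thus ?thesis by (simp add: fun_eq_iff)
qed

lemma eigenspace_iff:
  assumes v: "v \<in> L2"
  shows "y \<in> eigenspace (L_nonlocal \<alpha> v) \<mu> \<longleftrightarrow>
    (\<exists>g. L_zero y g \<and> (AE x in leb01. g x = \<mu> * y x - of_real \<alpha> * L2_inner y v * v x))"
proof
  assume "y \<in> eigenspace (L_nonlocal \<alpha> v) \<mu>"
  then obtain f g where "L_zero y g" "AE x in leb01. f x = \<mu> * y x"
    "AE x in leb01. f x = g x + of_real \<alpha> * L2_inner y v * v x"
    unfolding eigenspace_def L_nonlocal_def by blast
  moreover from this(2,3) have "AE x in leb01. g x = \<mu> * y x - of_real \<alpha> * L2_inner y v * v x"
    by eventually_elim (simp add: eq_diff_eq)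
  ultimately show "\<exists>g. L_zero y g \<and> (AE x in leb01. g x = \<mu> * y x - of_real \<alpha> * L2_inner y v * v x)"
    by blast
next
  assume "\<exists>g. L_zero y g \<and> (AE x in leb01. g x = \<mu> * y x - of_real \<alpha> * L2_inner y v * v x)"
  then obtain g where g: "L_zero y g" "AE x in leb01. g x = \<mu> * y x - of_real \<alpha> * L2_inner y v * v x" by blast
  have "AE x in leb01. \<mu> * y x = g x + of_real \<alpha> * L2_inner y v * v x"
    using g(2) by eventually_elim simp
  thus "y \<in> eigenspace (L_nonlocal \<alpha> v) \<mu>"
    unfolding eigenspace_def L_nonlocal_def using g(1) L2_cmult[OF L_zero_dom(1)[OF g(1)]] by blast
qed

lemma eigenspace_dom:
  assumes "y \<in> eigenspace (L_nonlocal \<alpha> v) \<mu>"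
  shows "y \<in> L2" "continuous_on {0..1} y" "\<And>x. x \<notin> {0..1} \<Longrightarrow> y x = 0"
  using assms L_zero_dom unfolding eigenspace_def L_nonlocal_def by blast+

text \<open>Dimensions are taken in the space of functions, so linear relations known almost
  everywhere have to hold at every point; continuity on the interval and the value 0 outside provide
  this.\<close>

lemma eigenspace_eqI:
  assumes "y \<in> eigenspace (L_nonlocal \<alpha> v) \<mu>" "z \<in> eigenspace (L_nonlocal \<alpha> v) \<mu>"
    "w \<in> eigenspace (L_nonlocal \<alpha> v) \<mu>" "AE x in leb01. y x = a * z x + b * w x"
  shows "y = (\<lambda>x. a * z x + b * w x)"
proof (rule continuous_AE_eqI[OF eigenspace_dom(2,3)[OF assms(1)] _ _ assms(4)])
  show "continuous_on {0..1} (\<lambda>x. a * z x + b * w x)"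
    by (intro continuous_intros eigenspace_dom(2)[OF assms(2)] eigenspace_dom(2)[OF assms(3)])
  show "a * z x + b * w x = 0" if "x \<notin> {0..1}" for x
    using eigenspace_dom(3)[OF assms(2) that] eigenspace_dom(3)[OF assms(3) that] by simp
qed

lemma eigenspace_fcoef:
  assumes v: "v \<in> L2" and y: "y \<in> eigenspace (L_nonlocal \<alpha> v) \<mu>"
  shows "(of_real (cube_freq n) - \<mu>) * fcoef y n = - of_real \<alpha> * L2_inner y v * fcoef v n"
proof -
  obtain g where g: "L_zero y g" "AE x in leb01. g x = \<mu> * y x - of_real \<alpha> * L2_inner y v * v x"
    using y eigenspace_iff[OF v] by blast
  note yg = L_zero_dom(1,2)[OF g(1)]
  have "of_real (cube_freq n) * fcoef y n = fcoef g n"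
    using L_zero_fcoef[OF g(1)] by simp
  also have "\<dots> = fcoef (\<lambda>x. \<mu> * y x - of_real \<alpha> * L2_inner y v * v x) n"
    by (intro fcoef_cong_AE[OF g(2)] L2_diff L2_cmult yg v)
  also have "\<dots> = \<mu> * fcoef y n - of_real \<alpha> * L2_inner y v * fcoef v n"
    using fcoef_diff[OF L2_cmult[OF yg(1)] L2_cmult[OF v]] by (simp add: fcoef_cmult)
  finally show ?thesis by (simp add: algebra_simps)
qed

text \<open>The coefficient equation forces membership in the domain: f = \<mu> u - \<alpha>
  \<open>L2_inner u v\<close> v has coefficients \<open>cube_freq n * fcoef u n\<close>, so its mean
  is 0, it can be integrated three times, and completeness identifies the result with
  \<open>u\<close>.\<close>

lemma eigenspace_intro:
  assumes v: "v \<in> L2" and u: "u \<in> L2"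
    and eq: "\<And>n. (of_real (cube_freq n) - \<mu>) * fcoef u n = - of_real \<alpha> * L2_inner u v * fcoef v n"
  obtains y where "y \<in> eigenspace (L_nonlocal \<alpha> v) \<mu>" "AE x in leb01. y x = u x"
proof -
  define f where "f x = \<mu> * u x - of_real \<alpha> * L2_inner u v * v x" for x
  have f: "f \<in> L2" unfolding f_def[abs_def] by (intro L2_diff L2_cmult u v)
  have fn: "fcoef f n = of_real (cube_freq n) * fcoef u n" for n
  proof -
    have "fcoef f n = \<mu> * fcoef u n - of_real \<alpha> * L2_inner u v * fcoef v n"
      unfolding f_def[abs_def] using fcoef_diff[OF L2_cmult[OF u] L2_cmult[OF v]] by (simp add: fcoef_cmult)
    also have "\<dots> = \<mu> * fcoef u n + (of_real (cube_freq n) - \<mu>) * fcoef u n" using eq[of n] by simp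
    also have "\<dots> = of_real (cube_freq n) * fcoef u n" by (simp add: algebra_simps)
    finally show ?thesis .
  qed
  have "fcoef f 0 = 0" using fn[of 0] by simp
  then obtain y where y: "L_zero y f" "fcoef y 0 = fcoef u 0"
    using L_zero_inverse[OF f] by blast
  note yL = L_zero_dom(1)[OF y(1)]
  have "fcoef y n = fcoef u n" for n
  proof (cases "n = 0")
    case False
    hence "cube_freq n \<noteq> 0" using cubes.lam_eq_iff[of n 0] by simp
    thus ?thesis using L_zero_fcoef[OF y(1), of n] fn[of n] by simp
  qed (use y in simp)
  hence yu: "AE x in leb01. y x = u x" by (rule fcoef_unique[OF yL u])
  have inner: "L2_inner y v = L2_inner u v"
    by (rule L2_inner_cong_AE[OF yu]) (use yL u v in \<open>auto simp: measurable_L2\<close>)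
  have "AE x in leb01. f x = \<mu> * y x - of_real \<alpha> * L2_inner y v * v x"
    using yu by eventually_elim (simp add: f_def inner)
  hence "y \<in> eigenspace (L_nonlocal \<alpha> v) \<mu>"
    using eigenspace_iff[OF v] y(1) by blast
  thus ?thesis using that yu by blast
qed

section \<open>The unperturbed resolvent applied to the potential\<close>

lemma summable_on_inverse_squares_int: "(\<lambda>n::int. 1 / (real_of_int n)\<^sup>2) summable_on UNIV"
proof (rule summable_on_comparison_test)
  \<comment> \<open>Parseval's identity for the sawtooth already contains the sum of inverse squares
    over the nonzero integers; at 0 the left side is 0 by division by zero.\<close>
  show "(\<lambda>n. 4 * pi\<^sup>2 * (cmod (fcoef (sawtooth 0) n))\<^sup>2) summable_on UNIV"
    by (intro summable_on_cmult_right has_sum_imp_summable[OF parseval[OF L2_sawtooth]])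
  show "1 / (real_of_int n)\<^sup>2 \<le> 4 * pi\<^sup>2 * (cmod (fcoef (sawtooth 0) n))\<^sup>2" for n
    by (cases "n = 0") (simp_all add: cmod_fcoef_sawtooth)
qed auto

text \<open>Since pi > 3, the factor (2 pi)^3 is at least 216. Any factor of at least 2 would let
  \<open>resolvent_coef_summable\<close> absorb the shift by \<open>a\<close>.\<close>

lemma abs_cube_freq_ge: "real_of_int \<bar>n\<bar> * 200 \<le> \<bar>cube_freq n\<bar>"
proof -
  have "(6::real)^3 \<le> (2 * pi)^3" using pi_gt3 by (intro power_mono) auto
  hence c: "200 \<le> (2 * pi)^3" by simp
  have "\<bar>n\<bar> \<le> \<bar>n\<bar>^3"
    by (cases "n = 0") (auto intro!: self_le_power)
  hence "real_of_int \<bar>n\<bar> \<le> \<bar>real_of_int n\<bar>^3" by (metis of_int_abs of_int_le_iff of_int_power)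
  hence "real_of_int \<bar>n\<bar> * 200 \<le> \<bar>real_of_int n\<bar>^3 * (2 * pi)^3"
    using c by (intro mult_mono) auto
  also have "\<dots> = \<bar>cube_freq n\<bar>"
    by (simp add: cube_freq_def power_mult_distrib abs_mult power_abs)
  finally show ?thesis .
qed

text \<open>Uniform convergence asks for absolute summability, not just square summability. Outside
  the finite set \<open>A\<close> the denominator is at least |n|, and a product xy is at most x^2 +
  y^2, applied to the coefficient and 1/|n|.\<close>

lemma resolvent_coef_summable:
  assumes v: "v \<in> L2"
  shows "(\<lambda>n. norm (fcoef v n / (of_real (cube_freq n) - of_real a))) summable_on UNIV"
proof -
  let ?c = "\<lambda>n. norm (fcoef v n / (of_real (cube_freq n) - complex_of_real a))"
  define A where "A = {n::int. real_of_int \<bar>n\<bar> \<le> \<bar>a\<bar>}"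
  have "A \<subseteq> {- \<lceil>\<bar>a\<bar>\<rceil>..\<lceil>\<bar>a\<bar>\<rceil>}"
  proof
    fix n assume "n \<in> A"
    hence "real_of_int \<bar>n\<bar> \<le> real_of_int \<lceil>\<bar>a\<bar>\<rceil>" unfolding A_def by (simp only: mem_Collect_eq) linarith
    hence "\<bar>n\<bar> \<le> \<lceil>\<bar>a\<bar>\<rceil>" by (simp only: of_int_le_iff)
    thus "n \<in> {- \<lceil>\<bar>a\<bar>\<rceil>..\<lceil>\<bar>a\<bar>\<rceil>}" by auto
  qed
  hence "finite A" using finite_subset by blast
  hence "?c summable_on A" by (rule summable_on_finite)
  moreover have "?c summable_on (- A)"
  proof (rule summable_on_comparison_test)
    have "(\<lambda>n. (cmod (fcoef v n))\<^sup>2 + 1 / (real_of_int n)\<^sup>2) summable_on UNIV"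
      by (intro summable_on_add summable_on_inverse_squares_int has_sum_imp_summable[OF parseval[OF v]])
    thus "(\<lambda>n. (cmod (fcoef v n))\<^sup>2 + 1 / (real_of_int n)\<^sup>2) summable_on (- A)"
      by (rule summable_on_subset_banach) simp
    show "?c n \<le> (cmod (fcoef v n))\<^sup>2 + 1 / (real_of_int n)\<^sup>2" if "n \<in> - A" for n
    proof -
      have n: "\<bar>a\<bar> < real_of_int \<bar>n\<bar>" using that by (simp add: A_def)
      hence n0: "real_of_int \<bar>n\<bar> > 0" by linarith
      have "real_of_int \<bar>n\<bar> \<le> \<bar>cube_freq n - a\<bar>" using n abs_cube_freq_ge[of n] by linarith
      hence le: "real_of_int \<bar>n\<bar> \<le> cmod (of_real (cube_freq n) - of_real a)"
        by (metis norm_of_real of_real_diff)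
      have "?c n = cmod (fcoef v n) / cmod (of_real (cube_freq n) - of_real a)" by (rule norm_divide)
      also have "\<dots> \<le> cmod (fcoef v n) / real_of_int \<bar>n\<bar>"
        using le n0 order.strict_trans2[OF n0 le] by (intro divide_left_mono mult_pos_pos) auto
      also have "\<dots> = cmod (fcoef v n) * (1 / real_of_int \<bar>n\<bar>)" by simp
      also have "\<dots> \<le> (cmod (fcoef v n))\<^sup>2 + (1 / real_of_int \<bar>n\<bar>)\<^sup>2"
      proof -
        have "0 \<le> cmod (fcoef v n) * (1 / real_of_int \<bar>n\<bar>)" using n0 by simp
        thus ?thesis
          using sum_squares_bound[of "cmod (fcoef v n)" "1 / real_of_int \<bar>n\<bar>"] by linarith
      qed
      also have "(1 / real_of_int \<bar>n\<bar>)\<^sup>2 = 1 / (real_of_int n)\<^sup>2" by (simp add: power_divide)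
      finally show ?thesis .
    qed
  qed auto
  ultimately have "?c summable_on (A \<union> - A)" by (intro summable_on_Un_disjoint) auto
  thus ?thesis by simp
qed

definition fcoef_sq :: "(real \<Rightarrow> complex) \<Rightarrow> int \<Rightarrow> real" where
  "fcoef_sq v n = (cmod (fcoef v n))\<^sup>2"

lemma fcoef_sq_summable: "v \<in> L2 \<Longrightarrow> fcoef_sq v summable_on UNIV"
  unfolding fcoef_sq_def[abs_def] by (rule has_sum_imp_summable[OF parseval])

lemma fcoef_sq_nonneg: "0 \<le> fcoef_sq v n"
  by (simp add: fcoef_sq_def)

lemma L2_inner_fexp_left: "L2_inner (fexp n) v = cnj (fcoef v n)"
  unfolding fcoef_def by (rule L2_inner_cnj)

text \<open>\<open>u\<close> is the unperturbed resolvent at \<open>a\<close> applied to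
  \<open>v\<close>, with the component at a pole dropped by division by zero; its inner product with
  \<open>v\<close> is the series in the determinant.\<close>

lemma resolvent_vector:
  assumes v: "v \<in> L2"
  obtains u where "u \<in> L2" "\<And>n. fcoef u n = fcoef v n / (of_real (cube_freq n) - of_real a)"
    "cubes.perturb_det \<alpha> (fcoef_sq v) (of_real a) = 1 + of_real \<alpha> * L2_inner u v"
proof -
  obtain u where u: "u \<in> L2"
    "\<And>h. h \<in> L2 \<Longrightarrow> ((\<lambda>n. fcoef v n / (of_real (cube_freq n) - of_real a) * L2_inner (fexp n) h) has_sum L2_inner u h) UNIV"
    "\<And>n. fcoef u n = fcoef v n / (of_real (cube_freq n) - of_real a)"
    using fourier_series_has_sum[OF resolvent_coef_summable[OF v, of a]] by blast
  have "((\<lambda>n. of_real (fcoef_sq v n) / (of_real (cube_freq n) - of_real a)) has_sum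
      cubes.pole_sum (\<lambda>n. of_real (fcoef_sq v n)) (of_real a)) UNIV"
    using fcoef_sq_summable[OF v] fcoef_sq_nonneg by (intro cubes.pole_sum_has_sum) simp
  moreover have "(\<lambda>n. fcoef v n / (of_real (cube_freq n) - of_real a) * L2_inner (fexp n) v) =
      (\<lambda>n. of_real (fcoef_sq v n) / (of_real (cube_freq n) - of_real a))"
    by (simp add: fun_eq_iff L2_inner_fexp_left fcoef_sq_def complex_norm_square del: of_real_power)
  ultimately have "cubes.pole_sum (\<lambda>n. of_real (fcoef_sq v n)) (of_real a) = L2_inner u v"
    using u(2)[OF v] has_sum_unique by metis
  thus ?thesis using that[OF u(1,3)] by (simp add: cubes.perturb_det_def)
qed

section \<open>Dimensions of the eigenspaces\<close>

lemma cfun_dim_0: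
  assumes "\<And>y. y \<in> V \<Longrightarrow> y = (\<lambda>x. 0)"
  shows "cfun.dim V = 0"
proof (rule cfun.dim_unique[of "{}"])
  show "V \<subseteq> cfun.span {}" using assms by (auto simp: zero_fun_def)
qed (auto simp: cfun.independent_empty)

lemma cfun_dim_1:
  assumes "z \<in> V" "z \<noteq> (\<lambda>x. 0)" "\<And>y. y \<in> V \<Longrightarrow> \<exists>k. y = (\<lambda>x. k * z x)"
  shows "cfun.dim V = 1"
proof (rule cfun.dim_unique[of "{z}"])
  show "V \<subseteq> cfun.span {z}" using assms(3) by (auto simp: cfun.span_singleton)
  show "cfun.independent {z}"
    using assms(2) by (simp add: cfun.independent_insert cfun.independent_empty zero_fun_def)
qed (use assms in auto)

lemma cfun_dim_2:
  assumes "z \<in> V" "w \<in> V" "w \<noteq> (\<lambda>x. 0)" "\<And>k. z \<noteq> (\<lambda>x. k * w x)"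
    "\<And>y. y \<in> V \<Longrightarrow> \<exists>a b. y = (\<lambda>x. a * z x + b * w x)"
  shows "cfun.dim V = 2"
proof (rule cfun.dim_unique[of "{z, w}"])
  have "z \<noteq> w" using assms(4)[of 1] by auto
  thus "card {z, w} = 2" by simp
  show "cfun.independent {z, w}"
    using assms(3,4) \<open>z \<noteq> w\<close>
    by (auto simp: cfun.independent_insert cfun.independent_empty cfun.span_singleton zero_fun_def)
  show "V \<subseteq> cfun.span {z, w}"
  proof
    fix y assume "y \<in> V"
    then obtain a b where y: "y = (\<lambda>x. a * z x + b * w x)" using assms(5) by blast
    have "(\<lambda>x. a * z x) + (\<lambda>x. b * w x) \<in> cfun.span {z, w}"
      by (intro cfun.span_add cfun.span_scale cfun.span_base) auto
    thus "y \<in> cfun.span {z, w}" by (simp add: y plus_fun_def)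
  qed
qed (use assms in auto)

text \<open>With s = \<open>L2_inner y v\<close>, an eigenvector has the form k
  \<open>fexp m\<close> - \<alpha> s u. Pairing with \<open>v\<close> gives s F(a) = k
  \<open>cnj (fcoef v m)\<close>, and the coefficient at a pole gives \<alpha> s
  \<open>fcoef v m\<close> = 0. A pole of nonzero weight kills both parameters; otherwise k is free
  exactly at a pole and \<alpha> s exactly at a zero of F.\<close>

lemma dim_eigenspace:
  assumes v: "v \<in> L2"
  shows "int (cfun.dim (eigenspace (L_nonlocal \<alpha> v) (of_real a))) =
    cubes.det_order \<alpha> (fcoef_sq v) a + (if \<exists>n. cube_freq n = a then 1 else 0)"
proof -
  let ?E = "eigenspace (L_nonlocal \<alpha> v) (of_real a)"
  let ?F = "cubes.perturb_det \<alpha> (fcoef_sq v) (of_real a)"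
  define idx where "idx \<longleftrightarrow> (\<exists>n. cube_freq n = a)"
  \<comment> \<open>The index of the pole \<open>a\<close> if there is one and arbitrary otherwise,
    so that all cases share one representation.\<close>
  obtain m where m: "\<And>n. n \<noteq> m \<Longrightarrow> cube_freq n \<noteq> a" "idx \<Longrightarrow> cube_freq m = a"
    unfolding idx_def by (metis cubes.lam_eq_iff)
  obtain u where u: "u \<in> L2" "\<And>n. fcoef u n = fcoef v n / (of_real (cube_freq n) - of_real a)"
    "?F = 1 + of_real \<alpha> * L2_inner u v"
    using resolvent_vector[OF v, of a \<alpha>] by blast
  have repr: "\<exists>k s :: complex. (AE x in leb01. y x = k * fexp m x - of_real \<alpha> * s * u x) \<and>
      s * ?F = k * cnj (fcoef v m) \<and> (\<not> idx \<longrightarrow> k = 0) \<and> (idx \<longrightarrow> of_real \<alpha> * s * fcoef v m = 0)"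
    if y: "y \<in> ?E" for y
  proof -
    define s where "s = L2_inner y v"
    \<comment> \<open>Only the coefficient at a pole escapes the division by
      \<open>cube_freq n - a\<close>; \<open>k\<close> is its deviation from the general formula and
      vanishes when \<open>a\<close> is not a pole.\<close>
    define k where "k = fcoef y m + of_real \<alpha> * s * fcoef u m"
    note yL = eigenspace_dom(1)[OF y]
    have coef: "(of_real (cube_freq n) - of_real a) * fcoef y n = - of_real \<alpha> * s * fcoef v n" for n
      using eigenspace_fcoef[OF v y] by (simp add: s_def)
    have non: "fcoef y n = - of_real \<alpha> * s * fcoef u n" if "cube_freq n \<noteq> a" for n
    proof -
      have d: "of_real (cube_freq n) - complex_of_real a \<noteq> 0" using that by simp
      hence "fcoef y n = - of_real \<alpha> * s * fcoef v n / (of_real (cube_freq n) - of_real a)"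
        using coef[of n] by (simp only: nonzero_eq_divide_eq[OF d] mult.commute)
      thus ?thesis by (simp add: u(2))
    qed
    have z: "(\<lambda>x. k * fexp m x - of_real \<alpha> * s * u x) \<in> L2"
      by (intro L2_diff L2_cmult L2_fexp u)
    have "fcoef (\<lambda>x. k * fexp m x - of_real \<alpha> * s * u x) n = k * (if m = n then 1 else 0) - of_real \<alpha> * s * fcoef u n" for n
      using fcoef_diff[OF L2_cmult[OF L2_fexp] L2_cmult[OF u(1)]] by (simp add: fcoef_cmult fcoef_fexp)
    hence "fcoef y n = fcoef (\<lambda>x. k * fexp m x - of_real \<alpha> * s * u x) n" for n
      using non[OF m(1), of n] by (cases "n = m") (auto simp: k_def)
    hence ae: "AE x in leb01. y x = k * fexp m x - of_real \<alpha> * s * u x"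
      by (rule fcoef_unique[OF yL z])
    have "s = L2_inner (\<lambda>x. k * fexp m x - of_real \<alpha> * s * u x) v"
      unfolding s_def[symmetric]
      using L2_inner_cong_AE[OF ae measurable_L2[OF yL] measurable_L2[OF z] v] by (simp add: s_def)
    also have "\<dots> = k * cnj (fcoef v m) - of_real \<alpha> * s * L2_inner u v"
      using L2_inner_diff_left[OF L2_cmult[OF L2_fexp] L2_cmult[OF u(1)] v]
      by (simp add: L2_inner_cmult_left L2_inner_fexp_left)
    finally have "s * ?F = k * cnj (fcoef v m)" unfolding u(3) by (simp add: algebra_simps)
    moreover have "\<not> idx \<longrightarrow> k = 0" using non[of m] by (auto simp: k_def idx_def)
    moreover have "idx \<longrightarrow> of_real \<alpha> * s * fcoef v m = 0" using coef[of m] m(2) by auto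
    ultimately show ?thesis using ae by blast
  qed
  show ?thesis
  proof (cases "idx \<and> \<alpha> * fcoef_sq v m \<noteq> 0")
    case True
    hence vm: "\<alpha> \<noteq> 0" "fcoef v m \<noteq> 0" "cube_freq m = a" "idx" using m(2) by (auto simp: fcoef_sq_def)
    have "y = (\<lambda>x. 0)" if y: "y \<in> ?E" for y
    proof -
      from repr[OF y] obtain k s where ks: "AE x in leb01. y x = k * fexp m x - of_real \<alpha> * s * u x"
        "s * ?F = k * cnj (fcoef v m)" "of_real \<alpha> * s * fcoef v m = 0" using vm(4) by blast
      from ks(3) vm have "s = 0" by simp
      with ks(2) vm have "k = 0" by simp
      with ks(1) \<open>s = 0\<close> show ?thesis
        using eigenspace_dom[OF y] by (intro continuous_AE_eq_0) auto
    qed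
    hence "cfun.dim ?E = 0" by (rule cfun_dim_0)
    moreover have "cubes.det_order \<alpha> (fcoef_sq v) a = -1"
      using True vm by (auto simp: cubes.det_order_def)
    ultimately show ?thesis using vm(4) by (simp add: idx_def)
  next
    case False
    have order: "cubes.det_order \<alpha> (fcoef_sq v) a = (if ?F = 0 then 1 else 0)"
    proof -
      have "\<not> (\<exists>n. cube_freq n = a \<and> \<alpha> * fcoef_sq v n \<noteq> 0)"
      proof
        assume "\<exists>n. cube_freq n = a \<and> \<alpha> * fcoef_sq v n \<noteq> 0"
        then obtain n where n: "cube_freq n = a" "\<alpha> * fcoef_sq v n \<noteq> 0" by blast
        have "n = m" using m(1)[of n] n(1) by argo
        thus False using False n unfolding idx_def by auto
      qed
      thus ?thesis unfolding cubes.det_order_def by (simp only: if_False)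
    qed
    have av: "of_real \<alpha> * fcoef v m = 0" if "idx" using False that by (auto simp: fcoef_sq_def)
    have repr2: "\<exists>k t. (AE x in leb01. y x = k * fexp m x + t * u x) \<and> (\<not> idx \<longrightarrow> k = 0) \<and> (?F \<noteq> 0 \<longrightarrow> t = 0)"
      if y: "y \<in> ?E" for y
    proof -
      from repr[OF y] obtain k s where ks: "AE x in leb01. y x = k * fexp m x - of_real \<alpha> * s * u x"
        "s * ?F = k * cnj (fcoef v m)" "\<not> idx \<longrightarrow> k = 0" by blast
      \<comment> \<open>After multiplication by \<alpha> the right side vanishes, since k = 0 off
        the poles and \<open>\<alpha> * fcoef v m\<close> is 0 at one: the two parameters
        decouple.\<close>
      have "of_real \<alpha> * s * ?F = k * cnj (of_real \<alpha> * fcoef v m)" using ks(2) by simp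
      also have "\<dots> = 0" using av ks(3) by (cases idx) simp_all
      finally have "?F \<noteq> 0 \<longrightarrow> - (of_real \<alpha> * s) = 0"
        unfolding neg_equal_0_iff_equal using mult_eq_0_iff by blast
      moreover have "AE x in leb01. y x = k * fexp m x + - (of_real \<alpha> * s) * u x"
        using ks(1) by eventually_elim simp
      ultimately show ?thesis using ks(3) by blast
    qed
    have ex1: "\<exists>y1\<in>?E. AE x in leb01. y1 x = fexp m x" if idx
    proof -
      have "(of_real (cube_freq n) - of_real a) * fcoef (fexp m) n =
          - of_real \<alpha> * L2_inner (fexp m) v * fcoef v n" for n
        using m(2)[OF that] av[OF that] by (auto simp: fcoef_fexp L2_inner_fexp_left)
      from eigenspace_intro[OF v L2_fexp this] show ?thesis by blast
    qed
    have ex2: "\<exists>y2\<in>?E. AE x in leb01. y2 x = u x" if F0: "?F = 0"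
    proof -
      have inner: "of_real \<alpha> * L2_inner u v = -1" using F0 u(3) by (simp add: add_eq_0_iff)
      hence "\<alpha> \<noteq> 0" by auto
      have "(of_real (cube_freq n) - of_real a) * fcoef u n = - of_real \<alpha> * L2_inner u v * fcoef v n" for n
      proof (cases "cube_freq n = a")
        case True
        hence "idx" "n = m" using m by (auto simp: idx_def)
        hence "fcoef v n = 0" using av \<open>\<alpha> \<noteq> 0\<close> by simp
        thus ?thesis using True by simp
      next
        case False
        thus ?thesis using inner u(2)[of n] by simp
      qed
      from eigenspace_intro[OF v u(1) this] show ?thesis by blast
    qed
    have u_nz: "y \<noteq> (\<lambda>x. 0)" if F0: "?F = 0" and y: "AE x in leb01. y x = u x" for y
    proof
      assume "y = (\<lambda>x. 0)"
      with y have "AE x in leb01. u x = 0" by (auto elim: eventually_mono)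
      hence "L2_inner u v = L2_inner (\<lambda>x. 0) v"
        by (intro L2_inner_cong_AE) (use u v in \<open>auto simp: measurable_L2\<close>)
      thus False using F0 u(3) by simp
    qed
    have fexp_nz: "y \<noteq> (\<lambda>x. 0)" if y: "AE x in leb01. y x = fexp m x" for y
    proof
      assume "y = (\<lambda>x. 0)"
      with y have "AE x in leb01. fexp m x = 0" by (auto elim: eventually_mono)
      hence "fcoef (fexp m) m = fcoef (\<lambda>x. 0) m" by (intro fcoef_cong_AE) auto
      thus False by (simp add: fcoef_fexp) (simp add: fcoef_def)
    qed
    consider "\<not> idx" "?F \<noteq> 0" | "idx" "?F \<noteq> 0" | "\<not> idx" "?F = 0" | "idx" "?F = 0" by blast
    hence "int (cfun.dim ?E) = (if ?F = 0 then 1 else 0) + (if idx then 1 else 0)"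
    proof cases
      case 1
      have "y = (\<lambda>x. 0)" if y: "y \<in> ?E" for y
        using repr2[OF y] 1 eigenspace_dom[OF y] by (intro continuous_AE_eq_0) auto
      hence "cfun.dim ?E = 0" by (rule cfun_dim_0)
      thus ?thesis using 1 by simp
    next
      case 2
      then obtain y1 where y1: "y1 \<in> ?E" "AE x in leb01. y1 x = fexp m x" using ex1 by blast
      have "\<exists>k. y = (\<lambda>x. k * y1 x)" if y: "y \<in> ?E" for y
      proof -
        obtain k where "AE x in leb01. y x = k * fexp m x" using repr2[OF y] 2 by auto
        hence "AE x in leb01. y x = k * y1 x + 0 * y1 x" using y1(2) by eventually_elim simp
        from eigenspace_eqI[OF y y1(1) y1(1) this] show ?thesis by auto
      qed
      moreover have "y1 \<noteq> (\<lambda>x. 0)" by (rule fexp_nz[OF y1(2)])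
      ultimately have "cfun.dim ?E = 1" using y1(1) by (intro cfun_dim_1) auto
      thus ?thesis using 2 by simp
    next
      case 3
      then obtain y2 where y2: "y2 \<in> ?E" "AE x in leb01. y2 x = u x" using ex2 by blast
      have "\<exists>k. y = (\<lambda>x. k * y2 x)" if y: "y \<in> ?E" for y
      proof -
        obtain t where "AE x in leb01. y x = t * u x" using repr2[OF y] 3 by auto
        hence "AE x in leb01. y x = t * y2 x + 0 * y2 x" using y2(2) by eventually_elim simp
        from eigenspace_eqI[OF y y2(1) y2(1) this] show ?thesis by auto
      qed
      moreover have "y2 \<noteq> (\<lambda>x. 0)" by (rule u_nz[OF 3(2) y2(2)])
      ultimately have "cfun.dim ?E = 1" using y2(1) by (intro cfun_dim_1) auto
      thus ?thesis using 3 by simp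
    next
      case 4
      then obtain y1 where y1: "y1 \<in> ?E" "AE x in leb01. y1 x = fexp m x" using ex1 by blast
      obtain y2 where y2: "y2 \<in> ?E" "AE x in leb01. y2 x = u x" using 4 ex2 by blast
      have "\<exists>k t. y = (\<lambda>x. k * y1 x + t * y2 x)" if y: "y \<in> ?E" for y
      proof -
        obtain k t where "AE x in leb01. y x = k * fexp m x + t * u x" using repr2[OF y] by auto
        hence "AE x in leb01. y x = k * y1 x + t * y2 x" using y1(2) y2(2) by eventually_elim simp
        from eigenspace_eqI[OF y y1(1) y2(1) this] show ?thesis by blast
      qed
      moreover have "y2 \<noteq> (\<lambda>x. 0)" by (rule u_nz[OF 4(2) y2(2)])
      moreover have "y1 \<noteq> (\<lambda>x. k * y2 x)" for k
      proof
        assume eq: "y1 = (\<lambda>x. k * y2 x)"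
        have "AE x in leb01. fexp m x = k * u x"
          using y1(2) y2(2) by eventually_elim (simp add: eq)
        hence "fcoef (fexp m) m = fcoef (\<lambda>x. k * u x) m"
          by (intro fcoef_cong_AE L2_cmult u L2_fexp)
        \<comment> \<open>Division by zero leaves \<open>u\<close> without a component at
          \<open>m\<close>, so \<open>fexp m\<close> is not a multiple of it.\<close>
        thus False using u(2)[of m] m(2)[OF 4(1)] by (simp add: fcoef_fexp fcoef_cmult)
      qed
      ultimately have "cfun.dim ?E = 2" using y1(1) y2(1) by (intro cfun_dim_2) auto
      thus ?thesis using 4 by simp
    qed
    thus ?thesis by (simp add: order idx_def)
  qed
qed

section \<open>From spectra to weights\<close>

lemma dim_eigenspace_pos_spectrum:
  assumes pos: "cfun.dim (eigenspace (L_nonlocal \<alpha> v) \<mu>) > 0"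
  shows "\<mu> \<in> op_spectrum (L_nonlocal \<alpha> v)"
proof (rule ccontr)
  let ?T = "L_nonlocal \<alpha> v"
  assume "\<mu> \<notin> op_spectrum ?T"
  then obtain C where C: "\<And>y f. ?T y f \<Longrightarrow> L2_norm y \<le> C * L2_norm (\<lambda>x. f x - \<mu> * y x)"
    unfolding op_spectrum_def resolvent_set_def by blast
  have "y = (\<lambda>x. 0)" if y: "y \<in> eigenspace ?T \<mu>" for y
  proof -
    note dom = eigenspace_dom[OF y]
    obtain f where f: "?T y f" "AE x in leb01. f x = \<mu> * y x" using y unfolding eigenspace_def by blast
    have fL: "f \<in> L2" using f(1) by (simp add: L_nonlocal_def)
    have "AE x in leb01. f x - \<mu> * y x = 0" using f(2) by eventually_elim simp
    hence "L2_sqnorm (\<lambda>x. f x - \<mu> * y x) = 0"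
      using L2_sqnorm_eq_0_iff[OF L2_diff[OF fL L2_cmult[OF dom(1)]]] by blast
    hence "L2_norm y \<le> 0" using C[OF f(1)] by (simp add: L2_norm_eq_sqrt)
    hence "L2_sqnorm y = 0" using L2_sqnorm_nonneg[of y] by (simp add: L2_norm_eq_sqrt)
    hence "AE x in leb01. y x = 0" using L2_sqnorm_eq_0_iff[OF dom(1)] by blast
    thus ?thesis using dom by (intro continuous_AE_eq_0) auto
  qed
  hence "cfun.dim (eigenspace ?T \<mu>) = 0" by (rule cfun_dim_0)
  thus False using pos by simp
qed

text \<open>Off the spectrum the eigenspace has dimension 0 by
  \<open>dim_eigenspace_pos_spectrum\<close>, so the listed pairs determine the dimension at every
  point.\<close>

lemma spectrum_mult_dim:
  assumes "spectrum_mult (L_nonlocal \<alpha> v) = spectrum_mult (L_nonlocal \<beta> w)"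
  shows "cfun.dim (eigenspace (L_nonlocal \<alpha> v) \<mu>) = cfun.dim (eigenspace (L_nonlocal \<beta> w) \<mu>)"
proof -
  have *: "cfun.dim (eigenspace (L_nonlocal \<alpha> v) \<mu>) = cfun.dim (eigenspace (L_nonlocal \<beta> w) \<mu>)"
    if "spectrum_mult (L_nonlocal \<alpha> v) = spectrum_mult (L_nonlocal \<beta> w)"
      "cfun.dim (eigenspace (L_nonlocal \<alpha> v) \<mu>) > 0" for \<alpha> \<beta> v w
  proof -
    have "(\<mu>, cfun.dim (eigenspace (L_nonlocal \<alpha> v) \<mu>)) \<in> spectrum_mult (L_nonlocal \<alpha> v)"
      using dim_eigenspace_pos_spectrum[OF that(2)] by (simp add: spectrum_mult_def)
    thus ?thesis unfolding that(1) by (simp add: spectrum_mult_def)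
  qed
  show ?thesis using *[OF assms] *[OF assms[symmetric]] by (metis gr0I)
qed

text \<open>In \<open>dim_eigenspace\<close> the summand for \<open>cube_freq n = a\<close> is the
  same for both potentials, so equal dimensions mean equal orders.\<close>

theorem spectrum_mult_fcoef:
  assumes "v \<in> L2" "w \<in> L2" "spectrum_mult (L_nonlocal \<alpha> v) = spectrum_mult (L_nonlocal \<beta> w)"
  shows "\<alpha> * fcoef_sq v n = \<beta> * fcoef_sq w n"
proof (rule cubes.perturb_det_order_unique)
  show "cubes.det_order \<alpha> (fcoef_sq v) a = cubes.det_order \<beta> (fcoef_sq w) a" for a
    using spectrum_mult_dim[OF assms(3), of "of_real a"] dim_eigenspace[OF assms(1), of \<alpha> a]
      dim_eigenspace[OF assms(2), of \<beta> a] by simp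
qed (auto simp: fcoef_sq_summable fcoef_sq_nonneg assms)

subsection \<open>Recovering the potential\<close>

lemma has_integral_leb01_reflect:
  fixes f :: "real \<Rightarrow> complex"
  assumes "(f has_integral I) {0..1}"
  shows "((\<lambda>x. f (1 - x)) has_integral I) {0..1}"
proof -
  have "(\<lambda>x::real. 1 - x) ` {0..1} = {0..1}"
    by (auto simp: image_iff intro!: bexI[of _ "1 - _"])
  thus ?thesis using has_integral_affinity[of f I 0 1 "-1" 1] assms by simp
qed

text \<open>The reflection x to 1 - x followed by conjugation fixes \<open>fexp (- n)\<close>, so
  the antisymmetry of \<open>v\<close> passes to its coefficients. In the gauge integral the
  exceptional set is absorbed as negligible.\<close>

lemma cnj_fcoef_antisymmetric:
  assumes v: "v \<in> L2" and sym: "AE x in leb01. cnj (v (1 - x)) = - v x"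
  shows "cnj (fcoef v n) = - fcoef v n"
proof -
  let ?e = "fexp (- n)"
  have "integrable leb01 (\<lambda>x. v x * ?e x)"
    using integrable_L2_mult[OF v L2_fexp[of n]] by (simp add: cnj_fexp)
  from has_integral_integral_lebesgue_on[OF this]
  have 1: "((\<lambda>x. v x * ?e x) has_integral fcoef v n) {0..1}"
    by (simp add: fcoef_def L2_inner_def cnj_fexp)
  hence "((\<lambda>x. cnj (v x * ?e x)) has_integral cnj (fcoef v n)) {0..1}"
    using has_integral_cnj[of "\<lambda>x. v x * ?e x"] by (simp add: o_def)
  hence 2: "((\<lambda>x. cnj (v (1 - x) * ?e (1 - x))) has_integral cnj (fcoef v n)) {0..1}"
    by (rule has_integral_leb01_reflect)
  have e: "cnj (?e (1 - x)) = ?e x" for x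
  proof -
    have "?e (1 - x) = ?e 1 * fexp n x"
      unfolding fexp_def by (simp add: exp_add[symmetric] algebra_simps)
    thus ?thesis by (simp add: cnj_fexp)
  qed
  from sym obtain N where N: "N \<in> null_sets lebesgue" "{x. \<not> (x \<in> {0..1} \<longrightarrow> cnj (v (1 - x)) = - v x)} \<subseteq> N"
    unfolding AE_leb01_iff by (auto simp: eventually_ae_filter)
  have "((\<lambda>x. - (v x * ?e x)) has_integral cnj (fcoef v n)) {0..1}"
  proof (rule has_integral_spike[OF _ _ 2])
    show "negligible N" using N(1) negligible_iff_null_sets by blast
    show "- (v x * ?e x) = cnj (v (1 - x) * ?e (1 - x))" if "x \<in> {0..1} - N" for x
      using that N(2) e[of x] by auto
  qed
  moreover have "((\<lambda>x. - (v x * ?e x)) has_integral - fcoef v n) {0..1}"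
    using 1 by (rule has_integral_neg)
  ultimately show ?thesis by (rule has_integral_unique)
qed

lemma L2_h_tilde: "h_tilde \<in> L2"
  unfolding h_tilde_def[abs_def] by (intro L2_continuous continuous_intros)

text \<open>The parabola has equal values at both ends, so one integration by parts reduces it to a
  linear function: the coefficient is i / (2 pi^2 n^2) for nonzero n, and i / 12 for n = 0.\<close>

lemma fcoef_h_tilde_nonzero: "fcoef h_tilde n \<noteq> 0"
proof -
  define q where "q x = complex_of_real ((x - 1/2)\<^sup>2)" for x
  have h: "fcoef h_tilde n = \<i> * fcoef q n"
    using fcoef_cmult[of \<i> q n] by (simp add: h_tilde_def[abs_def] q_def[abs_def] mult.commute)
  have "fcoef q n \<noteq> 0"
  proof (cases "n = 0")
    case True
    have "fcoef q 0 = of_real (((1 - 1/2)^3 + (1/2)^3) / 3)"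
      using LINT_leb01_polynomial(2)[of 1 "1/2"] by (simp add: fcoef_def L2_inner_def q_def[abs_def])
    also have "\<dots> = 1 / 12" by (simp add: power3_eq_cube)
    also have "\<dots> \<noteq> 0" by simp
    finally show ?thesis unfolding True .
  next
    case False
    have "sobolev_deriv q (\<lambda>x. 2 * complex_of_real (x - 1/2))"
      unfolding sobolev_deriv_def
    proof (intro conjI ballI)
      show "(\<lambda>x. 2 * complex_of_real (x - 1/2)) \<in> L2" by (intro L2_cmult L2_of_real_diff)
      fix x :: real assume x: "x \<in> {0..1}"
      have eq: "(LINT t|lebesgue_on {0..x}. 2 * complex_of_real (t - 1/2)) =
          2 * of_real (((x - 1/2)\<^sup>2 - (1/2)\<^sup>2) / 2)"
        unfolding Bochner_Integration.integral_mult_right_zero LINT_leb01_polynomial(1)[OF x] ..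
      show "q x = q 0 + (LINT t|lebesgue_on {0..x}. 2 * complex_of_real (t - 1/2))"
        unfolding eq by (simp add: q_def diff_divide_distrib)
    qed
    from fcoef_sobolev_deriv[OF this, of n]
    have "2 * (\<i> / (2 * of_real pi * of_int n)) = 2 * of_real pi * \<i> * of_int n * fcoef q n"
      unfolding fcoef_cmult fcoef_of_real_diff[OF False] by (simp add: q_def power2_eq_square)
    thus ?thesis using False by auto
  qed
  thus ?thesis by (simp add: h)
qed

lemma cnj_eq_uminus_imp_Re_0: "cnj z = - z \<Longrightarrow> Re z = 0"
  by (simp add: complex_eq_iff)

text \<open>On the imaginary axis |a| = |b| leaves only the sign open. The cross term 2
  \<open>Im a * Im h\<close> in |a + h|^2 fixes it, because h is not 0.\<close>

lemma imaginary_eqI: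
  assumes "Re a = 0" "Re b = 0" "Re h = 0" "h \<noteq> 0"
    "cmod a ^ 2 = cmod b ^ 2" "cmod (a + h) ^ 2 = cmod (b + h) ^ 2"
  shows "a = b"
proof -
  have "(Im a)\<^sup>2 = (Im b)\<^sup>2" "(Im a + Im h)\<^sup>2 = (Im b + Im h)\<^sup>2"
    using assms by (simp_all add: cmod_power2)
  hence "Im h * (Im a - Im b) = 0" by (simp add: power2_eq_square algebra_simps)
  moreover have "Im h \<noteq> 0" using assms by (simp add: complex_eq_iff)
  ultimately show ?thesis using assms by (simp add: complex_eq_iff)
qed

text \<open>For \<alpha> = 0 the perturbed operators reduce to \<open>L_zero\<close> and their
  spectra say nothing about \<open>v\<close>; hence the condition in the second conclusion.\<close>

theorem nonlocal_potential_unique: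
  assumes v: "v \<in> L2" "AE x in leb01. cnj (v (1 - x)) = - v x" "L2_norm v = 1"
    and w: "w \<in> L2" "AE x in leb01. cnj (w (1 - x)) = - w x" "L2_norm w = 1"
    and spec: "spectrum_mult (L_nonlocal \<alpha> v) = spectrum_mult (L_nonlocal \<beta> w)"
      "spectrum_mult (L_nonlocal \<alpha> (\<lambda>x. v x + h_tilde x)) =
       spectrum_mult (L_nonlocal \<beta> (\<lambda>x. w x + h_tilde x))"
  shows "\<alpha> = \<beta>" "\<alpha> \<noteq> 0 \<Longrightarrow> AE x in leb01. v x = w x"
proof -
  have hs: "(fcoef_sq u has_sum 1) UNIV" if "u \<in> L2" "L2_norm u = 1" for u
    using parseval[OF that(1)] that(2) by (simp add: fcoef_sq_def[abs_def] L2_norm_eq_sqrt)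
  have eq: "\<alpha> * fcoef_sq v n = \<beta> * fcoef_sq w n" for n
    by (rule spectrum_mult_fcoef[OF v(1) w(1) spec(1)])
  have "((\<lambda>n. \<alpha> * fcoef_sq v n) has_sum (\<alpha> * 1)) UNIV" "((\<lambda>n. \<beta> * fcoef_sq w n) has_sum (\<beta> * 1)) UNIV"
    by (intro has_sum_cmult_right hs v w)+
  thus \<alpha>\<beta>: "\<alpha> = \<beta>" using eq has_sum_unique by fastforce
  assume "\<alpha> \<noteq> 0"
  have h: "AE x in leb01. cnj (h_tilde (1 - x)) = - h_tilde x"
    by (intro AE_I2) (simp add: h_tilde_def power2_eq_square algebra_simps)
  have eq': "\<alpha> * fcoef_sq (\<lambda>x. v x + h_tilde x) n = \<beta> * fcoef_sq (\<lambda>x. w x + h_tilde x) n" for n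
    by (intro spectrum_mult_fcoef L2_add v w L2_h_tilde spec(2))
  have Re: "Re (fcoef v n) = 0" "Re (fcoef w n) = 0" "Re (fcoef h_tilde n) = 0" for n
    using cnj_fcoef_antisymmetric v(1,2) w(1,2) h L2_h_tilde cnj_eq_uminus_imp_Re_0 by blast+
  have "fcoef v n = fcoef w n" for n
  proof (rule imaginary_eqI[OF Re(1,2,3) fcoef_h_tilde_nonzero])
    show "cmod (fcoef v n) ^ 2 = cmod (fcoef w n) ^ 2"
      using eq[of n] \<alpha>\<beta> \<open>\<alpha> \<noteq> 0\<close> by (simp add: fcoef_sq_def)
    show "cmod (fcoef v n + fcoef h_tilde n) ^ 2 = cmod (fcoef w n + fcoef h_tilde n) ^ 2"
      using eq'[of n] \<alpha>\<beta> \<open>\<alpha> \<noteq> 0\<close> by (simp add: fcoef_sq_def fcoef_add v(1) w(1) L2_h_tilde)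
  qed
  thus "AE x in leb01. v x = w x" by (rule fcoef_unique[OF v(1) w(1)])
qed

theorem corollary5p7:
  shows "\<exists>(rec_alpha :: (complex \<times> nat) set \<Rightarrow> (complex \<times> nat) set \<Rightarrow> (complex \<times> nat) set \<Rightarrow> real)
          (rec_v :: (complex \<times> nat) set \<Rightarrow> (complex \<times> nat) set \<Rightarrow> (complex \<times> nat) set \<Rightarrow> real \<Rightarrow> complex).
    \<forall>(\<alpha>::real) (v :: real \<Rightarrow> complex).
      v \<in> L2 \<and> (AE x in leb01. cnj (v (1 - x)) = - v x) \<and> L2_norm v = 1 \<longrightarrow>
      rec_alpha (spectrum_mult L_zero) (spectrum_mult (L_nonlocal \<alpha> v))
        (spectrum_mult (L_nonlocal \<alpha> (\<lambda>x. v x + h_tilde x))) = \<alpha> \<and>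
      (\<alpha> \<noteq> 0 \<longrightarrow>
        (AE x in leb01. rec_v (spectrum_mult L_zero) (spectrum_mult (L_nonlocal \<alpha> v))
          (spectrum_mult (L_nonlocal \<alpha> (\<lambda>x. v x + h_tilde x))) x = v x))"
proof -
  define P where "P S1 S2 \<beta> w \<longleftrightarrow> w \<in> L2 \<and> (AE x in leb01. cnj (w (1 - x)) = - w x) \<and> L2_norm w = 1 \<and>
      S1 = spectrum_mult (L_nonlocal \<beta> w) \<and> S2 = spectrum_mult (L_nonlocal \<beta> (\<lambda>x. w x + h_tilde x))"
    for S1 S2 \<beta> w
  \<comment> \<open>Any potential compatible with the two spectra is picked;
    \<open>nonlocal_potential_unique\<close> makes the pick agree with the given one, for
    \<open>v\<close> up to a null set.\<close>
  define R where "R S1 S2 = (SOME p. P S1 S2 (fst p) (snd p))" for S1 S2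
  have "fst (R S1 S2) = \<alpha> \<and> (\<alpha> \<noteq> 0 \<longrightarrow> (AE x in leb01. snd (R S1 S2) x = v x))"
    if "P S1 S2 \<alpha> v" for S1 S2 \<alpha> v
  proof -
    have "P S1 S2 (fst (R S1 S2)) (snd (R S1 S2))"
      unfolding R_def by (rule someI[of _ "(\<alpha>, v)"]) (simp add: that)
    thus ?thesis
      using that nonlocal_potential_unique[of "snd (R S1 S2)" v "fst (R S1 S2)" \<alpha>] unfolding P_def by simp
  qed
  thus ?thesis
    unfolding P_def
    by (intro exI[of _ "\<lambda>_ S1 S2. fst (R S1 S2)"] exI[of _ "\<lambda>_ S1 S2. snd (R S1 S2)"]) blast
qed

end
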